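(* Let $G_n=(V_n,E_n,\mathcal A_n)$ be a sequence of decorated graphs with $|V_n|=n$ and $Z(G_n)\ne0$ for all $n$. Consider either the Type I interpolation (in which case each $G_n$ is an independent set model) or the Type II interpolation. Suppose that for every $\epsilon>0$ there exists $c(\epsilon)$ such that for any sequence $\Lambda_n\subset V_n$, $\eta_n:\Lambda_n\to[K]$ with $Z(G_{n,\Lambda_n,\eta_n})\neq 0$, $$(1-\epsilon)Z(G_{n,\Lambda_n,\eta_n})\le\exp\big(T_m(G_{n,\Lambda_n,\eta_n},1)\big)\le(1+\epsilon)Z(G_{n,\Lambda_n,\eta_n})$$ whenever $m\ge c(\epsilon)\log n$ and $n$ is large enough. Let $R_n$ be a sequence of positive integers with $R_n=\omega(\log n)$. Then $$\lim_{n\to\infty}\ \sup_{S_n,\Lambda_n\subset V_n,\ \eta_n:\Lambda_n\to[K]}\rho_{R_n}\big(G_{n,\Lambda_n,\eta_n},S_n\big)=0,$$ where the supremum is over $\eta_n$ with $Z(G_{n,\Lambda_n,\eta_n})\neq0$.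
   Context: Decorated graphs. Fix a positive integer $K$, $[K]=\{1,\dots,K\}$. A decorated graph $G=(V,E,\mathcal A)$ is a finite simple undirected graph $(V,E)$ with a vector $a^u\in\mathbb R_{\ge0}^K$ for each $u\in V$ and a symmetric matrix $A^{(u,v)}\in\mathbb R_{\ge 0}^{K\times K}$ for each edge $(u,v)\in E$. In $A^{(u,v)}_{i,j}$ the first index refers to $u$ and the second to $v$; for modified (possibly non-symmetric) matrices below, the convention is $A^{(v,u)}_{j,i}=A^{(u,v)}_{i,j}$. For $\phi:V\to[K]$ put $w(\phi)=\prod_{u\in V}a^u_{\phi(u)}\prod_{(u,v)\in E}A^{(u,v)}_{\phi(u),\phi(v)}$; the partition function is $Z(G)=\sum_{\phi:V\to[K]}w(\phi)$. When $Z(G)>0$ the Gibbs measure is $\mu(\phi)=w(\phi)/Z(G)$; $\mu(G,S,\sigma)$ denotes the $\mu$-probability that $\phi(u)=\sigma(u)$ for all $u\in S$, and $\mu(G,S,\sigma|T,\tau)$ the conditional probability of this event given $\phi(v)=\tau(v)$ for all $v\in T$. Distances. $B(S,R)$ is the set of nodes at graph distance (in $(V,E)$) at most $R$ from some node of $S$, and $\partial B(S,R)=B(S,R)\setminus B(S,R-1)$ is the set of nodes at distance exactly $R$ from $S$. Type II interpolation. For a decorated graph $G$ let $J$ be the $K\times K$ all-ones matrix and let $G(z)$ have $a^u(z)=a^u$ and $A^{(u,v)}(z)=J+z(A^{(u,v)}-J)$. Then $Z(G(z))$ is a polynomial in $z$ with $Z(G(1))=Z(G)$ and $Z(G(0))=\prod_{u}\sum_i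 a^u_i$. For $S\subset V$, $\sigma:S\to[K]$, the reduced graph $G_{S,\sigma}=(V,E,\mathcal A_{S,\sigma})$ has the same vectors $a^u$, and each matrix entry $A^{(u,v)}_{i,j}$ is multiplied by $\mathbf 1(i=\sigma(u))$ if $u\in S$ and by $\mathbf 1(j=\sigma(v))$ if $v\in S$ (by both if $u,v\in S$), and is unchanged if $u,v\notin S$. $Z(G_{S,\sigma}(z))$ denotes the partition function of the Type II interpolation of $G_{S,\sigma}$. Type I interpolation (independent set / hard-core model with fugacity $\lambda>0$, the fugacity being part of the decoration). Here $K=2$, $a^u=(1,\lambda)$ for all $u$, $A^{(u,v)}_{2,2}=0$ and all other entries of $A^{(u,v)}$ equal $1$, so $Z(G)=\sum_I\lambda^{|I|}$ over independent sets $I$ (color $2$ means "in $I$"). The interpolation is $Z(G(z))=\sum_I(z\lambda)^{|I|}$. For $S\subset V$, $\sigma:S\to\{1,2\}$, the reduced model $G_{S,\sigma}$ is the model restricted to configurations agreeing with $\sigma$ on $S$, so $Z(G_{S,\sigma})=\sum_I\lambda^{|I|}$ over independent sets $I$ with $I\cap S=\sigma^{-1}(2)$. When $Z(G_{S,\sigma})\ne0$, let $\tilde G$ be the graph obtained from $(V,E)$ by deleting all $u\in S$ with $\sigma(u)=1$ and deleting every $u\in S$ with $\sigma(u)=2$ together with all its neighbors, and let $k=|\sigma^{-1}(2)|$; the interpolation is $Z(G_{S,\sigma}(z))=\lambda^k\sum_{I}(z\lambda)^{|I|}$, the sum over independent sets $I$ of $\tilde G$ (so at $z=1$ it equals $Z(G_{S,\sigma})$).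 Truncated Taylor expansions. In both types, for real $m\ge0$, $$T_m(G_{S,\sigma},z)=\sum_{0\le k\le m}\frac{1}{k!}f^{(k)}(0)z^k,\qquad f(z)=\log Z(G_{S,\sigma}(z)),$$ where the sum is over integers $k$ and the logarithm is the branch near $z=0$ that is real at the positive number $Z(G_{S,\sigma}(0))$. The notation $G_{n,\Lambda_n,\eta_n}$ means $(G_n)_{\Lambda_n,\eta_n}$. Range-$R$ dependence. For a decorated graph $G$ with $Z(G)>0$, $S\subset V$ and a positive integer $R$, $$\rho_R(G,S)=\max_{\sigma,\tau_1,\tau_2}\big|\mu(G,S,\sigma|\partial B(S,R),\tau_1)-\mu(G,S,\sigma|\partial B(S,R),\tau_2)\big|,$$ the maximum over $\sigma:S\to[K]$ and $\tau_1,\tau_2:\partial B(S,R)\to[K]$ having positive probability under the Gibbs measure of $G$. The conclusion is called the asymptotic Strong Spatial Mixing of the sequence at distances $R_n$. $R_n=\omega(\log n)$ means $R_n/\log n\to\infty$. *)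

theory Defs
  imports "HOL-Complex_Analysis.Complex_Analysis" "HOL-Library.Extended_Nat"
begin

text \<open>
  Colours are the natural numbers \<open>1, \<dots>, K\<close>. The scalars are left polymorphic: decorated graphs
  proper have real entries, their interpolations at a complex parameter have complex ones.
  Edges are two-element sets of vertices; \<open>amat G u v i j\<close> is the entry \<open>A\<^sup>(\<^sup>u\<^sup>,\<^sup>v\<^sup>)\<^sub>i\<^sub>,\<^sub>j\<close>, so \<open>i\<close> refers
  to \<open>u\<close> and \<open>j\<close> to \<open>v\<close>.
\<close>

record ('v, 'a) dgraph =
  verts :: "'v set"
  edges :: "'v set set"
  avec :: "'v \<Rightarrow> nat \<Rightarrow> 'a"
  amat :: "'v \<Rightarrow> 'v \<Rightarrow> nat \<Rightarrow> nat \<Rightarrow> 'a"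

definition decorated_graph :: "nat \<Rightarrow> ('v, real) dgraph \<Rightarrow> bool" where
  "decorated_graph K G \<longleftrightarrow>
     finite (verts G) \<and>
     (\<forall>e\<in>edges G. e \<subseteq> verts G \<and> card e = 2) \<and>
     (\<forall>u\<in>verts G. \<forall>i\<in>{1..K}. avec G u i \<ge> 0) \<and>
     (\<forall>u v. {u, v} \<in> edges G \<longrightarrow> (\<forall>i\<in>{1..K}. \<forall>j\<in>{1..K}.
        amat G u v i j \<ge> 0 \<and> amat G u v i j = amat G u v j i \<and> amat G v u j i = amat G u v i j))"

text \<open>
  The factor of an undirected edge does not depend on the order in which its endpoints are
  listed, because of the convention \<open>A\<^sup>(\<^sup>v\<^sup>,\<^sup>u\<^sup>)\<^sub>j\<^sub>,\<^sub>i = A\<^sup>(\<^sup>u\<^sup>,\<^sup>v\<^sup>)\<^sub>i\<^sub>,\<^sub>j\<close>.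
\<close>

definition edge_factor :: "('v, 'a) dgraph \<Rightarrow> ('v \<Rightarrow> nat) \<Rightarrow> 'v set \<Rightarrow> 'a" where
  "edge_factor G \<phi> e = (THE x. \<exists>u v. e = {u, v} \<and> x = amat G u v (\<phi> u) (\<phi> v))"

lemma edge_factor_doubleton:
  assumes "u \<noteq> v" and "amat G v u (\<phi> v) (\<phi> u) = amat G u v (\<phi> u) (\<phi> v)"
  shows "edge_factor G \<phi> {u, v} = amat G u v (\<phi> u) (\<phi> v)"
  unfolding edge_factor_def
proof (rule the_equality)
  show "\<exists>u' v'. {u, v} = {u', v'} \<and>
          amat G u v (\<phi> u) (\<phi> v) = amat G u' v' (\<phi> u') (\<phi> v')"
    by blast
  fix x assume "\<exists>u' v'. {u, v} = {u', v'} \<and> x = amat G u' v' (\<phi> u') (\<phi> v')"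
  then show "x = amat G u v (\<phi> u) (\<phi> v)"
    using assms by (auto simp: doubleton_eq_iff)
qed

definition weight :: "('v, 'a::comm_semiring_1) dgraph \<Rightarrow> ('v \<Rightarrow> nat) \<Rightarrow> 'a" where
  "weight G \<phi> = (\<Prod>u\<in>verts G. avec G u (\<phi> u)) * (\<Prod>e\<in>edges G. edge_factor G \<phi> e)"

definition partition_fun :: "nat \<Rightarrow> ('v, 'a::comm_semiring_1) dgraph \<Rightarrow> 'a" where
  "partition_fun K G = (\<Sum>\<phi> \<in> verts G \<rightarrow>\<^sub>E {1..K}. weight G \<phi>)"

definition gibbs :: "nat \<Rightarrow> ('v, real) dgraph \<Rightarrow> ('v \<Rightarrow> nat) \<Rightarrow> real" where
  "gibbs K G \<phi> = weight G \<phi> / partition_fun K G"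

definition gibbs_prob :: "nat \<Rightarrow> ('v, real) dgraph \<Rightarrow> (('v \<Rightarrow> nat) \<Rightarrow> bool) \<Rightarrow> real" where
  "gibbs_prob K G P = (\<Sum>\<phi> | \<phi> \<in> verts G \<rightarrow>\<^sub>E {1..K} \<and> P \<phi>. gibbs K G \<phi>)"

definition gibbs_marginal :: "nat \<Rightarrow> ('v, real) dgraph \<Rightarrow> 'v set \<Rightarrow> ('v \<Rightarrow> nat) \<Rightarrow> real" where
  "gibbs_marginal K G S \<sigma> = gibbs_prob K G (\<lambda>\<phi>. \<forall>u\<in>S. \<phi> u = \<sigma> u)"

definition gibbs_cond ::
  "nat \<Rightarrow> ('v, real) dgraph \<Rightarrow> 'v set \<Rightarrow> ('v \<Rightarrow> nat) \<Rightarrow> 'v set \<Rightarrow> ('v \<Rightarrow> nat) \<Rightarrow> real" where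
  "gibbs_cond K G S \<sigma> T \<tau> =
     gibbs_prob K G (\<lambda>\<phi>. (\<forall>u\<in>S. \<phi> u = \<sigma> u) \<and> (\<forall>v\<in>T. \<phi> v = \<tau> v)) / gibbs_marginal K G T \<tau>"

definition adj_rel :: "('v, 'a) dgraph \<Rightarrow> ('v \<times> 'v) set" where
  "adj_rel G = {(u, v). {u, v} \<in> edges G}"

definition graph_dist :: "('v, 'a) dgraph \<Rightarrow> 'v \<Rightarrow> 'v \<Rightarrow> enat" where
  "graph_dist G u v = (INF k \<in> {k. (u, v) \<in> adj_rel G ^^ k}. enat k)"

definition gball :: "('v, 'a) dgraph \<Rightarrow> 'v set \<Rightarrow> nat \<Rightarrow> 'v set" where
  "gball G S R = {v \<in> verts G. \<exists>u\<in>S. graph_dist G u v \<le> enat R}"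

text \<open>Only meant for \<open>R \<ge> 1\<close>.\<close>

definition gboundary :: "('v, 'a) dgraph \<Rightarrow> 'v set \<Rightarrow> nat \<Rightarrow> 'v set" where
  "gboundary G S R = gball G S R - gball G S (R - 1)"

definition range_dep :: "nat \<Rightarrow> nat \<Rightarrow> ('v, real) dgraph \<Rightarrow> 'v set \<Rightarrow> real" where
  "range_dep K R G S =
     Max {\<bar>gibbs_cond K G S \<sigma> (gboundary G S R) \<tau>1 - gibbs_cond K G S \<sigma> (gboundary G S R) \<tau>2\<bar>
          | \<sigma> \<tau>1 \<tau>2.
            \<sigma> \<in> S \<rightarrow>\<^sub>E {1..K} \<and>
            \<tau>1 \<in> gboundary G S R \<rightarrow>\<^sub>E {1..K} \<and> gibbs_marginal K G (gboundary G S R) \<tau>1 > 0 \<and>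
            \<tau>2 \<in> gboundary G S R \<rightarrow>\<^sub>E {1..K} \<and> gibbs_marginal K G (gboundary G S R) \<tau>2 > 0}"

datatype interpolation = TypeI | TypeII

definition hard_core :: "('v, real) dgraph \<Rightarrow> bool" where
  "hard_core G \<longleftrightarrow>
     (\<exists>lam>0. \<forall>u\<in>verts G. avec G u 1 = 1 \<and> avec G u 2 = lam) \<and>
     (\<forall>u v. {u, v} \<in> edges G \<longrightarrow>
        (\<forall>i\<in>{1,2}. \<forall>j\<in>{1,2}. amat G u v i j = (if i = 2 \<and> j = 2 then 0 else 1)))"

text \<open>
  The reduced graph \<open>G\<^sub>S\<^sub>,\<^sub>\<sigma>\<close>. For Type I it is the model restricted to the configurations that
  agree with \<open>\<sigma>\<close> on \<open>S\<close>, written as a decorated graph by zeroing the node weights of the other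
  colours on \<open>S\<close> (see \<open>weight_reduced_TypeI\<close>). For Type II only the edge matrices change, so a
  node of \<open>S\<close> without neighbours is not pinned.
\<close>

definition reduced_graph ::
  "interpolation \<Rightarrow> ('v, real) dgraph \<Rightarrow> 'v set \<Rightarrow> ('v \<Rightarrow> nat) \<Rightarrow> ('v, real) dgraph" where
  "reduced_graph ty G S \<sigma> = (case ty of
     TypeI \<Rightarrow> G\<lparr>avec := (\<lambda>u i. avec G u i * of_bool (u \<in> S \<longrightarrow> i = \<sigma> u))\<rparr>
   | TypeII \<Rightarrow> G\<lparr>amat := (\<lambda>u v i j. amat G u v i j
                   * of_bool (u \<in> S \<longrightarrow> i = \<sigma> u) * of_bool (v \<in> S \<longrightarrow> j = \<sigma> v))\<rparr>)"

lemma weight_reduced_TypeI: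
  assumes "finite (verts G)" and "S \<subseteq> verts G"
  shows "weight (reduced_graph TypeI G S \<sigma>) \<phi> = weight G \<phi> * of_bool (\<forall>u\<in>S. \<phi> u = \<sigma> u)"
proof -
  have "(\<Prod>u\<in>verts G. of_bool (u \<in> S \<longrightarrow> \<phi> u = \<sigma> u)) = (of_bool (\<forall>u\<in>S. \<phi> u = \<sigma> u) :: real)"
  proof (cases "\<forall>u\<in>S. \<phi> u = \<sigma> u")
    case False
    then obtain u where "u \<in> S" "\<phi> u \<noteq> \<sigma> u" by blast
    with assms show ?thesis
      by (auto simp: False intro!: prod_zero bexI[of _ u])
  qed (simp add: prod.neutral)
  moreover have "edge_factor (reduced_graph TypeI G S \<sigma>) \<phi> e = edge_factor G \<phi> e" for e
    by (simp add: edge_factor_def reduced_graph_def)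
  ultimately show ?thesis
    by (simp add: weight_def prod.distrib reduced_graph_def)
qed

text \<open>\<open>fugacity\<close> recovers \<open>\<lambda>\<close> from the decoration; it is meaningful if \<open>G\<close> is a nonempty \<open>hard_core\<close> graph.\<close>

definition fugacity :: "('v, real) dgraph \<Rightarrow> real" where
  "fugacity G = avec G (SOME u. u \<in> verts G) 2"

definition indep_sets :: "'v set \<Rightarrow> 'v set set \<Rightarrow> 'v set set" where
  "indep_sets V E = {I. I \<subseteq> V \<and> (\<forall>e\<in>E. \<not> e \<subseteq> I)}"

definition tilde_verts :: "('v, real) dgraph \<Rightarrow> 'v set \<Rightarrow> ('v \<Rightarrow> nat) \<Rightarrow> 'v set" where
  "tilde_verts G S \<sigma> = verts G - {u \<in> S. \<sigma> u = 1}
     - {u \<in> S. \<sigma> u = 2} - {v. \<exists>u\<in>S. \<sigma> u = 2 \<and> {u, v} \<in> edges G}"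

definition tilde_edges :: "('v, real) dgraph \<Rightarrow> 'v set \<Rightarrow> ('v \<Rightarrow> nat) \<Rightarrow> 'v set set" where
  "tilde_edges G S \<sigma> = {e \<in> edges G. e \<subseteq> tilde_verts G S \<sigma>}"

definition interp_TypeII :: "('v, real) dgraph \<Rightarrow> complex \<Rightarrow> ('v, complex) dgraph" where
  "interp_TypeII G z =
     \<lparr>verts = verts G, edges = edges G,
      avec = (\<lambda>u i. of_real (avec G u i)),
      amat = (\<lambda>u v i j. 1 + z * (of_real (amat G u v i j) - 1))\<rparr>"

text \<open>\<open>Z(G\<^sub>S\<^sub>,\<^sub>\<sigma>(z))\<close>; for Type I only meant when \<open>Z(G\<^sub>S\<^sub>,\<^sub>\<sigma>) \<noteq> 0\<close>.\<close>

definition interp_Z ::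
  "interpolation \<Rightarrow> nat \<Rightarrow> ('v, real) dgraph \<Rightarrow> 'v set \<Rightarrow> ('v \<Rightarrow> nat) \<Rightarrow> complex \<Rightarrow> complex" where
  "interp_Z ty K G S \<sigma> z = (case ty of
     TypeI \<Rightarrow> of_real (fugacity G) ^ card {u \<in> S. \<sigma> u = 2} *
              (\<Sum>I \<in> indep_sets (tilde_verts G S \<sigma>) (tilde_edges G S \<sigma>).
                 (z * of_real (fugacity G)) ^ card I)
   | TypeII \<Rightarrow> partition_fun K (interp_TypeII (reduced_graph TypeII G S \<sigma>) z))"

text \<open>
  \<open>T\<^sub>m(G\<^sub>S\<^sub>,\<^sub>\<sigma>, z)\<close>. As \<open>Z(G\<^sub>S\<^sub>,\<^sub>\<sigma>(0)) > 0\<close>, the principal branch \<open>Ln\<close> is, near \<open>z = 0\<close>, the branch of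
  the logarithm that is real at \<open>Z(G\<^sub>S\<^sub>,\<^sub>\<sigma>(0))\<close>.
\<close>

definition taylor_T ::
  "interpolation \<Rightarrow> nat \<Rightarrow> ('v, real) dgraph \<Rightarrow> 'v set \<Rightarrow> ('v \<Rightarrow> nat) \<Rightarrow> real \<Rightarrow> complex \<Rightarrow> complex" where
  "taylor_T ty K G S \<sigma> m z =
     (\<Sum>k | real k \<le> m. (deriv ^^ k) (\<lambda>w. Ln (interp_Z ty K G S \<sigma> w)) 0 / fact k * z ^ k)"

end

theory Submission
  imports Defs
begin

text \<open>
  Let \<open>Z\<^sub>\<Theta>(z)\<close> be the interpolation with the nodes of \<open>\<Theta>\<close> pinned, expanded over edge sets (Type II) or
  independent sets (Type I) weighted by \<open>z\<close> to the cardinality. In the product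
  \<open>Z\<^bsub>\<Lambda> \<union> S \<union> T\<^esub> Z\<^bsub>\<Lambda>\<^esub>\<close> a pair of sets that is too small to connect \<open>S\<close> with \<open>T\<close> can be swapped on the
  part connected to \<open>S\<close>, which gives a pair counted in \<open>Z\<^bsub>\<Lambda> \<union> T\<^esub> Z\<^bsub>\<Lambda> \<union> S\<^esub>\<close>. So the two products agree to
  an order proportional to the distance of \<open>S\<close> and \<open>T\<close>, and for \<open>m\<close> below this order the truncated
  expansions satisfy \<open>T\<^sub>m(\<Lambda> \<union> S \<union> T) + T\<^sub>m(\<Lambda>) = T\<^sub>m(\<Lambda> \<union> T) + T\<^sub>m(\<Lambda> \<union> S)\<close>. By the approximation hypothesis
  \<open>Z\<^bsub>\<Lambda> \<union> S \<union> T\<^esub> / Z\<^bsub>\<Lambda> \<union> T\<^esub>\<close> and \<open>Z\<^bsub>\<Lambda> \<union> S\<^esub> / Z\<^bsub>\<Lambda>\<^esub>\<close> then agree up to a factor close to 1: conditioning on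
  the boundary hardly changes the law of the colours on \<open>S\<close>.
\<close>

subsection \<open>Generating functions and Taylor coefficients of logarithms\<close>

text \<open>Exchanging the values of two configurations on \<open>W\<close> is an involution on
  pairs of configurations, so it reindexes the double sum obtained by multiplying out. The same
  exchange serves for the colours near \<open>S\<close> in the Type II coefficients and for the
  colours of isolated nodes.\<close>

lemma sum_mult_sum_override_on:
  fixes f g f' g' :: "('v \<Rightarrow> 'c) \<Rightarrow> 'a::semiring_0"
  assumes "\<And>\<phi> \<psi>. \<phi> \<in> V \<rightarrow>\<^sub>E A \<Longrightarrow> \<psi> \<in> V \<rightarrow>\<^sub>E A \<Longrightarrow>
      f \<phi> * g \<psi> = f' (override_on \<phi> \<psi> W) * g' (override_on \<psi> \<phi> W)"
  shows "sum f (V \<rightarrow>\<^sub>E A) * sum g (V \<rightarrow>\<^sub>E A) = sum f' (V \<rightarrow>\<^sub>E A) * sum g' (V \<rightarrow>\<^sub>E A)"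
proof -
  let ?\<Omega> = "V \<rightarrow>\<^sub>E A"
  let ?swap = "\<lambda>(\<phi>, \<psi>). (override_on \<phi> \<psi> W, override_on \<psi> \<phi> W)"
  have over: "override_on \<phi> \<psi> W \<in> ?\<Omega>" if "\<phi> \<in> ?\<Omega>" "\<psi> \<in> ?\<Omega>" for \<phi> \<psi>
    using that by (auto simp: PiE_iff extensional_def override_on_def)
  have "(\<Sum>(\<phi>, \<psi>)\<in>?\<Omega> \<times> ?\<Omega>. f \<phi> * g \<psi>) = (\<Sum>(\<phi>, \<psi>)\<in>?\<Omega> \<times> ?\<Omega>. f' \<phi> * g' \<psi>)"
    by (rule sum.reindex_bij_witness[where i = ?swap and j = ?swap])
       (auto simp: over assms override_on_def fun_eq_iff simp del: PiE_iff)
  then show ?thesis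
    by (simp add: sum_product sum.cartesian_product)
qed

text \<open>The interpolation polynomial as a formal power series: \<open>X\<close> is the edge set
  for Type II and the node set for Type I. The weights \<open>c\<close> are real, but the series is
  complex because its logarithm is taken with \<open>Ln\<close>.\<close>

definition gen_fps :: "'x set \<Rightarrow> ('x set \<Rightarrow> real) \<Rightarrow> complex fps" where
  "gen_fps X c = (\<Sum>A\<in>Pow X. fps_const (of_real (c A)) * fps_X ^ card A)"

lemma has_fps_expansion_gen_fps:
  "(\<lambda>z. \<Sum>A\<in>Pow X. of_real (c A) * z ^ card A) has_fps_expansion gen_fps X c"
  unfolding gen_fps_def by (intro fps_expansion_intros)

lemma fps_nth_gen_fps_0:
  assumes "finite X"
  shows "fps_nth (gen_fps X c) 0 = of_real (c {})"
proof -
  have "fps_nth (gen_fps X c) 0 = (\<Sum>A\<in>Pow X. if A = {} then of_real (c A) else 0)"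
    unfolding gen_fps_def fps_sum_nth
    using assms by (intro sum.cong) (auto simp: card_eq_0_iff dest: finite_subset)
  also have "\<dots> = of_real (c {})"
    using assms by (simp add: sum.delta)
  finally show ?thesis .
qed

lemma fps_nth_gen_fps_mult:
  assumes "finite X"
  shows "fps_nth (gen_fps X c * gen_fps X d) k =
    of_real (\<Sum>(A, B) | A \<subseteq> X \<and> B \<subseteq> X \<and> card A + card B = k. c A * d B)"
proof -
  have "gen_fps X c * gen_fps X d =
      (\<Sum>(A, B)\<in>Pow X \<times> Pow X. fps_const (of_real (c A * d B)) * fps_X ^ (card A + card B))"
    unfolding gen_fps_def sum_product sum.cartesian_product
    by (intro sum.cong) (auto simp: power_add mult_ac simp flip: fps_const_mult)
  then have "fps_nth (gen_fps X c * gen_fps X d) k =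
      (\<Sum>p\<in>Pow X \<times> Pow X. if card (fst p) + card (snd p) = k
         then of_real (c (fst p) * d (snd p)) else 0)"
    by (auto simp: fps_sum_nth case_prod_unfold intro!: sum.cong)
  also have "\<dots> = (\<Sum>p\<in>{p \<in> Pow X \<times> Pow X. card (fst p) + card (snd p) = k}.
      of_real (c (fst p) * d (snd p)))"
    using assms by (subst sum.inter_filter) auto
  also have "{p \<in> Pow X \<times> Pow X. card (fst p) + card (snd p) = k} =
      {(A, B). A \<subseteq> X \<and> B \<subseteq> X \<and> card A + card B = k}"
    by auto
  finally show ?thesis
    by (simp add: case_prod_unfold)
qed

lemma card_swap:
  assumes "finite A" "finite B"
  shows "card (A - U \<union> B \<inter> U) + card (B - U \<union> A \<inter> U) = card A + card B"
proof -
  have "card (A - U \<union> B \<inter> U) = card (A - U) + card (B \<inter> U)"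
    using assms by (intro card_Un_disjoint) auto
  moreover have "card (B - U \<union> A \<inter> U) = card (B - U) + card (A \<inter> U)"
    using assms by (intro card_Un_disjoint) auto
  moreover have "card A = card (A - U) + card (A \<inter> U)" "card B = card (B - U) + card (B \<inter> U)"
    using assms by (auto simp: card_Diff_subset_Int card_mono)
  ultimately show ?thesis by simp
qed

text \<open>The exchanged region depends on the pair only through \<open>A \<union> B\<close>, which
  the exchange leaves unchanged, so exchanging twice gives back the pair. The total cardinality is
  preserved as well, hence the exchange permutes the pairs that contribute to the coefficient of
  order \<open>k\<close>.\<close>

lemma fps_nth_gen_fps_mult_swap:
  fixes W :: "'x set \<Rightarrow> 'x set"
  assumes "finite X" and "k < r"
    and swap: "\<And>A B. A \<subseteq> X \<Longrightarrow> B \<subseteq> X \<Longrightarrow> card A + card B < r \<Longrightarrow>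
      c A * d B = c' (A - W (A \<union> B) \<union> B \<inter> W (A \<union> B)) * d' (B - W (A \<union> B) \<union> A \<inter> W (A \<union> B))"
  shows "fps_nth (gen_fps X c * gen_fps X d) k = fps_nth (gen_fps X c' * gen_fps X d') k"
proof -
  let ?s = "\<lambda>(A, B). (A - W (A \<union> B) \<union> B \<inter> W (A \<union> B), B - W (A \<union> B) \<union> A \<inter> W (A \<union> B))"
  have un: "(A - U \<union> B \<inter> U) \<union> (B - U \<union> A \<inter> U) = A \<union> B" for A B U :: "'x set"
    by blast
  have inv: "?s (?s p) = p" for p
    by (cases p) (simp only: prod.case un, blast)
  have cd: "card (A - U \<union> B \<inter> U) + card (B - U \<union> A \<inter> U) = card A + card B"
    if "A \<subseteq> X" "B \<subseteq> X" for A B U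
    using that assms(1) by (intro card_swap) (auto dest: finite_subset)
  have "(\<Sum>(A, B) | A \<subseteq> X \<and> B \<subseteq> X \<and> card A + card B = k. c A * d B) =
        (\<Sum>(A, B) | A \<subseteq> X \<and> B \<subseteq> X \<and> card A + card B = k. c' A * d' B)"
  proof (rule sum.reindex_bij_witness[where i = ?s and j = ?s])
    fix p assume p: "p \<in> {(A, B). A \<subseteq> X \<and> B \<subseteq> X \<and> card A + card B = k}"
    show "?s (?s p) = p" "?s (?s p) = p" by (rule inv)+
    show "?s p \<in> {(A, B). A \<subseteq> X \<and> B \<subseteq> X \<and> card A + card B = k}"
      using p by (cases p) (auto simp: cd)
    then show "?s p \<in> {(A, B). A \<subseteq> X \<and> B \<subseteq> X \<and> card A + card B = k}" .
    show "(case ?s p of (A, B) \<Rightarrow> c' A * d' B) = (case p of (A, B) \<Rightarrow> c A * d B)"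
      using p swap \<open>k < r\<close> by (cases p) auto
  qed
  then show ?thesis
    using assms(1) by (simp add: fps_nth_gen_fps_mult)
qed

lemma fps_nth_mult_eq_0:
  fixes F G :: "'a::semiring_0 fps"
  assumes "\<And>j. j \<le> k \<Longrightarrow> fps_nth F j = 0"
  shows "fps_nth (F * G) k = 0"
  using assms by (simp add: fps_mult_nth)

text \<open>The logarithm is captured by its derivative: near 0 the values of \<open>f\<close> stay
  off the branch cut, so \<open>f' = (Ln f)' * f\<close> holds there, and uniqueness of expansions
  turns this into an identity of formal power series. Together with the constant term it determines
  \<open>L\<close>.\<close>

lemma has_fps_expansion_Ln:
  fixes P :: "complex fps"
  assumes f: "f has_fps_expansion P" and P0: "fps_nth P 0 = of_real p" and p: "p > 0"
  obtains L where "(\<lambda>z. Ln (f z)) has_fps_expansion L" "fps_nth L 0 = of_real (ln p)"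
    "fps_deriv P = fps_deriv L * P"
proof -
  have f0: "f 0 = of_real p"
    using has_fps_expansion_imp_0_eq_fps_nth_0[OF f] P0 by simp
  have an: "f analytic_on {0}"
    using has_fps_expansion_imp_analytic_0[OF f] .
  have "(\<lambda>z. Ln (f z)) analytic_on {0}"
    by (intro analytic_on_ln an) (use f0 p in \<open>auto simp: complex_nonpos_Reals_iff\<close>)
  then obtain L where L: "(\<lambda>z. Ln (f z)) has_fps_expansion L"
    using analytic_at_imp_has_fps_expansion_0 by blast
  have L0: "fps_nth L 0 = of_real (ln p)"
    using has_fps_expansion_imp_0_eq_fps_nth_0[OF L] f0 p by (simp add: Ln_of_real)
  have "isCont f 0"
    using has_fps_expansion_imp_continuous[OF f] by simp
  then have "(f \<longlongrightarrow> f 0) (nhds 0)"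
    by (simp add: isCont_def tendsto_nhds_iff)
  moreover have "open (- \<real>\<^sub>\<le>\<^sub>0 :: complex set)" "f 0 \<in> - \<real>\<^sub>\<le>\<^sub>0"
    using f0 p by (auto simp: complex_nonpos_Reals_iff open_Compl)
  ultimately have ev: "\<forall>\<^sub>F z in nhds 0. f z \<in> - \<real>\<^sub>\<le>\<^sub>0"
    using topological_tendstoD by blast
  have ev_an: "\<forall>\<^sub>F z in nhds 0. f analytic_on {z}"
    using an by (metis (no_types, lifting) analytic_at analytic_on_open analytic_on_analytic_at eventually_nhds)
  have "\<forall>\<^sub>F z in nhds 0. deriv (\<lambda>z. Ln (f z)) z * f z = deriv f z"
    using ev ev_an
  proof eventually_elim
    case (elim z)
    have "(f has_field_derivative deriv f z) (at z)"
      using elim(2) by (meson analytic_on_imp_differentiable_at DERIV_deriv_iff_field_differentiable singletonI)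
    then have "((\<lambda>z. Ln (f z)) has_field_derivative deriv f z / f z) (at z)"
      using elim(1) by (auto intro!: derivative_eq_intros simp: field_simps)
    moreover have "f z \<noteq> 0" using elim(1) by auto
    ultimately show ?case by (simp add: DERIV_imp_deriv)
  qed
  moreover have "(\<lambda>z. deriv (\<lambda>z. Ln (f z)) z * f z) has_fps_expansion fps_deriv L * P"
    by (intro fps_expansion_intros L f)
  ultimately have "deriv f has_fps_expansion fps_deriv L * P"
    by (simp add: has_fps_expansion_cong)
  moreover have "deriv f has_fps_expansion fps_deriv P"
    by (intro fps_expansion_intros f)
  ultimately have "fps_deriv P = fps_deriv L * P"
    using fps_expansion_unique_complex by blast
  with L L0 show ?thesis using that by blast
qed

text \<open>Let \<open>D\<close> be the difference of the two sums of logarithms and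
  \<open>E = a * b - c * d\<close>. The derivative identities give
  \<open>D' * (a * b) = E' - E * (Lc + Ld)'\<close>. As \<open>E\<close> vanishes below order
  \<open>r\<close> and \<open>a * b\<close> is invertible, \<open>D'\<close> vanishes below order
  \<open>r - 1\<close>, which leaves only the constant term of \<open>D\<close>.\<close>

lemma higher_deriv_Ln_add_eq:
  fixes a b c d :: "complex fps" and p q s t :: real
  assumes exps: "f has_fps_expansion a" "g has_fps_expansion b"
      "h has_fps_expansion c" "i has_fps_expansion d"
    and nth0: "fps_nth a 0 = of_real p" "fps_nth b 0 = of_real q"
      "fps_nth c 0 = of_real s" "fps_nth d 0 = of_real t"
    and pos: "p > 0" "q > 0" "s > 0" "t > 0"
    and eq: "\<And>j. j < r \<Longrightarrow> fps_nth (a * b) j = fps_nth (c * d) j"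
    and "k < r"
  shows "(deriv ^^ k) (\<lambda>z. Ln (f z)) 0 + (deriv ^^ k) (\<lambda>z. Ln (g z)) 0 =
         (deriv ^^ k) (\<lambda>z. Ln (h z)) 0 + (deriv ^^ k) (\<lambda>z. Ln (i z)) 0"
proof -
  obtain La where La: "(\<lambda>z. Ln (f z)) has_fps_expansion La" "fps_nth La 0 = of_real (ln p)"
      "fps_deriv a = fps_deriv La * a"
    using has_fps_expansion_Ln[OF exps(1) nth0(1) pos(1)] .
  obtain Lb where Lb: "(\<lambda>z. Ln (g z)) has_fps_expansion Lb" "fps_nth Lb 0 = of_real (ln q)"
      "fps_deriv b = fps_deriv Lb * b"
    using has_fps_expansion_Ln[OF exps(2) nth0(2) pos(2)] .
  obtain Lc where Lc: "(\<lambda>z. Ln (h z)) has_fps_expansion Lc" "fps_nth Lc 0 = of_real (ln s)"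
      "fps_deriv c = fps_deriv Lc * c"
    using has_fps_expansion_Ln[OF exps(3) nth0(3) pos(3)] .
  obtain Ld where Ld: "(\<lambda>z. Ln (i z)) has_fps_expansion Ld" "fps_nth Ld 0 = of_real (ln t)"
      "fps_deriv d = fps_deriv Ld * d"
    using has_fps_expansion_Ln[OF exps(4) nth0(4) pos(4)] .
  define D where "D = La + Lb - (Lc + Ld)"
  define E where "E = a * b - c * d"
  have E: "fps_nth E j = 0" if "j < r" for j
    using eq[OF that] by (simp add: E_def)
  have unit: "fps_nth (a * b) 0 \<noteq> 0"
    using nth0 pos by simp
  have "fps_deriv D * (a * b) = fps_deriv E - E * fps_deriv (Lc + Ld)"
    by (simp add: D_def E_def La(3) Lb(3) Lc(3) Ld(3) algebra_simps)
  then have D: "fps_deriv D = (fps_deriv E - E * fps_deriv (Lc + Ld)) * inverse (a * b)"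
    by (metis (no_types, lifting) inverse_mult_eq_1' mult.assoc mult.right_neutral unit)
  have "fps_nth D k = 0"
  proof (cases k)
    case 0
    \<comment> \<open>The complex logarithm is additive only up to multiples of 2 pi i; here the
      constant terms are real logarithms of positive numbers, for which additivity is exact.\<close>
    have "of_real (p * q) = (of_real (s * t) :: complex)"
      using eq[of 0] \<open>k < r\<close> 0 nth0 by simp
    then have "p * q = s * t"
      using of_real_eq_iff by blast
    then have "ln p + ln q = ln s + ln t"
      using pos by (metis ln_mult_pos)
    then have "complex_of_real (ln p + ln q) = of_real (ln s + ln t)"
      by simp
    then show ?thesis
      by (simp add: D_def 0 La(2) Lb(2) Lc(2) Ld(2))
  next
    case (Suc l)
    have "fps_nth (fps_deriv D) l = 0"
      unfolding D
    proof (rule fps_nth_mult_eq_0)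
      fix j assume "j \<le> l"
      then have "Suc j < r" using Suc \<open>k < r\<close> by simp
      then show "fps_nth (fps_deriv E - E * fps_deriv (Lc + Ld)) j = 0"
        using E fps_nth_mult_eq_0[of j E] by auto
    qed
    then have "of_nat (Suc l) * fps_nth D (Suc l) = 0"
      by (metis Suc_eq_plus1 fps_deriv_nth)
    then show ?thesis
      using Suc by (metis mult_eq_0_iff of_nat_neq_0)
  qed
  then have "fps_nth La k + fps_nth Lb k = fps_nth Lc k + fps_nth Ld k"
    by (simp add: D_def)
  then show ?thesis
    unfolding fps_nth_fps_expansion[OF La(1)] fps_nth_fps_expansion[OF Lb(1)]
      fps_nth_fps_expansion[OF Lc(1)] fps_nth_fps_expansion[OF Ld(1)]
    by (simp add: field_simps)
qed

lemma higher_deriv_Ln_gen_fps_add_eq: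
  assumes fin: "finite X" and pos: "a {} > 0" "b {} > 0" "c {} > 0" "d {} > 0"
    and eq: "\<And>j. j < r \<Longrightarrow> fps_nth (gen_fps X a * gen_fps X b) j = fps_nth (gen_fps X c * gen_fps X d) j"
    and "k < r"
  shows "(deriv ^^ k) (\<lambda>z. Ln (\<Sum>A\<in>Pow X. of_real (a A) * z ^ card A)) 0 +
         (deriv ^^ k) (\<lambda>z. Ln (\<Sum>A\<in>Pow X. of_real (b A) * z ^ card A)) 0 =
         (deriv ^^ k) (\<lambda>z. Ln (\<Sum>A\<in>Pow X. of_real (c A) * z ^ card A)) 0 +
         (deriv ^^ k) (\<lambda>z. Ln (\<Sum>A\<in>Pow X. of_real (d A) * z ^ card A)) 0"
  by (rule higher_deriv_Ln_add_eq[OF has_fps_expansion_gen_fps[of a] has_fps_expansion_gen_fps[of b]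
        has_fps_expansion_gen_fps[of c] has_fps_expansion_gen_fps[of d]
        fps_nth_gen_fps_0[OF fin] fps_nth_gen_fps_0[OF fin]
        fps_nth_gen_fps_0[OF fin] fps_nth_gen_fps_0[OF fin] pos eq \<open>k < r\<close>])

text \<open>A shortest path visits no node twice, and every node after the first lies in the range
  of \<open>r\<close>.\<close>

lemma relpow_le_card_Range:
  assumes "(s, t) \<in> r\<^sup>*" and "Range r \<subseteq> U" and "finite U"
  obtains k where "k \<le> card U" "(s, t) \<in> r ^^ k"
proof -
  define n where "n = (LEAST n. (s, t) \<in> r ^^ n)"
  have n: "(s, t) \<in> r ^^ n"
    unfolding n_def using assms(1) by (metis LeastI rtrancl_imp_relpow)
  have least: "n \<le> m" if "(s, t) \<in> r ^^ m" for m
    unfolding n_def using that by (rule Least_le)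
  obtain f where f: "f 0 = s" "f n = t" "\<And>i. i < n \<Longrightarrow> (f i, f (Suc i)) \<in> r"
    using n unfolding relpow_fun_conv by blast
  have path: "(f i, f j) \<in> r ^^ (j - i)" if "i \<le> j" "j \<le> n" for i j
    unfolding relpow_fun_conv
    by (rule exI[of _ "\<lambda>l. f (i + l)"]) (use that f(3) in auto)
  \<comment> \<open>If a node were repeated, cutting out the loop between the two visits would give
    a shorter path.\<close>
  have ne: "f i \<noteq> f j" if "i < j" "j \<le> n" for i j
  proof
    assume "f i = f j"
    then have "(s, f j) \<in> r ^^ i" "(f j, t) \<in> r ^^ (n - j)"
      using path[of 0 i] path[of j n] that f by auto
    then have "(s, t) \<in> r ^^ (i + (n - j))"
      by (auto simp: relpow_add)
    then show False using least that by fastforce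
  qed
  \<comment> \<open>Index 0 is left out because the start \<open>s\<close> need not belong to
    \<open>U\<close>.\<close>
  have "inj_on f {1..n}"
  proof (rule inj_onI)
    fix i j assume "i \<in> {1..n}" "j \<in> {1..n}" "f i = f j"
    then show "i = j"
      using ne[of i j] ne[of j i] by (cases i j rule: linorder_cases) auto
  qed
  moreover have "f ` {1..n} \<subseteq> U"
  proof
    fix x assume "x \<in> f ` {1..n}"
    then obtain j where j: "x = f j" "1 \<le> j" "j \<le> n" by auto
    then obtain i where "x = f (Suc i)" "i < n" by (cases j) auto
    then show "x \<in> U" using f(3) assms(2) by blast
  qed
  ultimately have "n \<le> card U"
    using card_inj_on_le[of f "{1..n}" U] assms(3) by simp
  then show ?thesis using that n by blast
qed

text \<open>Where \<open>p x > 0\<close> the ratio bounds suffice. Where \<open>p x = 0\<close> they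
  say nothing about \<open>q x\<close>, but all the mass of \<open>p\<close> then lies elsewhere,
  where \<open>p\<close> is at most \<open>(1 + \<delta>) * q\<close>; so \<open>q\<close> has mass
  at least \<open>1 / (1 + \<delta>)\<close> off \<open>x\<close>, and little is left for
  \<open>q x\<close>.\<close>

lemma abs_diff_le_of_ratio_bounds:
  fixes p q :: "'x \<Rightarrow> real"
  assumes "finite A" "\<delta> \<ge> 0"
    and nonneg: "\<And>x. x \<in> A \<Longrightarrow> p x \<ge> 0" "\<And>x. x \<in> A \<Longrightarrow> q x \<ge> 0"
    and sums: "sum p A = 1" "sum q A = 1"
    and ratio: "\<And>x. x \<in> A \<Longrightarrow> p x > 0 \<Longrightarrow> p x \<le> (1 + \<delta>) * q x"
      "\<And>x. x \<in> A \<Longrightarrow> p x > 0 \<Longrightarrow> q x \<le> (1 + \<delta>) * p x"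
    and "x \<in> A"
  shows "\<bar>p x - q x\<bar> \<le> \<delta>"
proof -
  have le1: "p x \<le> 1" "q x \<le> 1"
    using member_le_sum[of x A p] member_le_sum[of x A q] assms by auto
  show ?thesis
  proof (cases "p x > 0")
    case True
    then have "p x - q x \<le> \<delta> * q x" "q x - p x \<le> \<delta> * p x"
      using ratio[OF \<open>x \<in> A\<close>] by (simp_all add: algebra_simps)
    moreover have "\<delta> * q x \<le> \<delta>" "\<delta> * p x \<le> \<delta>"
      using le1 \<open>\<delta> \<ge> 0\<close> by (simp_all add: mult_left_le)
    ultimately show ?thesis by linarith
  next
    case False
    then have px: "p x = 0" using nonneg \<open>x \<in> A\<close> by force
    have "1 = sum p (A - {x})"
      using sums(1) \<open>finite A\<close> \<open>x \<in> A\<close> px by (simp add: sum_diff1)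
    also have "\<dots> \<le> (\<Sum>y\<in>A - {x}. (1 + \<delta>) * q y)"
    proof (rule sum_mono)
      fix y assume "y \<in> A - {x}"
      then show "p y \<le> (1 + \<delta>) * q y"
        using ratio(1)[of y] nonneg[of y] \<open>\<delta> \<ge> 0\<close> by (cases "p y > 0") auto
    qed
    also have "\<dots> = (1 + \<delta>) * (1 - q x)"
      using sums(2) \<open>finite A\<close> \<open>x \<in> A\<close> by (simp add: sum_diff1 flip: sum_distrib_left)
    finally have "q x \<le> \<delta> * (1 - q x)"
      by (simp add: algebra_simps)
    also have "\<dots> \<le> \<delta>"
      using nonneg(2)[OF \<open>x \<in> A\<close>] \<open>\<delta> \<ge> 0\<close> by (simp add: mult_left_le)
    finally show ?thesis
      using px nonneg(2)[OF \<open>x \<in> A\<close>] by simp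
  qed
qed

subsection \<open>Reduced graphs\<close>

lemma finite_edges:
  assumes "decorated_graph K G"
  shows "finite (edges G)"
proof -
  have "edges G \<subseteq> Pow (verts G)" "finite (verts G)"
    using assms by (auto simp: decorated_graph_def)
  then show ?thesis by (meson finite_Pow_iff finite_subset)
qed

lemma edgeE:
  assumes "decorated_graph K G" "e \<in> edges G"
  obtains u v where "e = {u, v}" "u \<noteq> v" "u \<in> verts G" "v \<in> verts G"
proof -
  have "e \<subseteq> verts G" "card e = 2"
    using assms by (auto simp: decorated_graph_def)
  then show ?thesis using that by (auto simp: card_2_iff)
qed

lemma edge_factor_cong:
  assumes "\<And>u. u \<in> e \<Longrightarrow> \<phi> u = \<psi> u"
  shows "edge_factor G \<phi> e = edge_factor G \<psi> e"
proof -
  have "(\<exists>u v. e = {u, v} \<and> x = amat G u v (\<phi> u) (\<phi> v)) \<longleftrightarrow>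
        (\<exists>u v. e = {u, v} \<and> x = amat G u v (\<psi> u) (\<psi> v))" for x
    using assms by (intro iff_exI conj_cong) auto
  then show ?thesis by (simp add: edge_factor_def)
qed

lemma amat_swap:
  assumes "decorated_graph K G" "{u, v} \<in> edges G" "i \<in> {1..K}" "j \<in> {1..K}"
  shows "amat G v u j i = amat G u v i j" "amat G u v i j \<ge> 0"
  using assms unfolding decorated_graph_def by metis+

lemma edge_factor_nonneg:
  assumes "decorated_graph K G" "e \<in> edges G" "\<phi> \<in> verts G \<rightarrow>\<^sub>E {1..K}"
  shows "edge_factor G \<phi> e \<ge> 0"
proof -
  obtain u v where e: "e = {u, v}" "u \<noteq> v" "u \<in> verts G" "v \<in> verts G"
    using edgeE assms(1,2) .
  have c: "\<phi> u \<in> {1..K}" "\<phi> v \<in> {1..K}" using assms(3) e by (blast dest: PiE_mem)+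
  show ?thesis
    using amat_swap[OF assms(1) _ c] assms(2) e by (simp add: edge_factor_doubleton)
qed

lemma weight_nonneg:
  assumes "decorated_graph K G" "\<phi> \<in> verts G \<rightarrow>\<^sub>E {1..K}"
  shows "weight G \<phi> \<ge> 0"
proof -
  have "avec G u (\<phi> u) \<ge> 0" if "u \<in> verts G" for u
    using assms that PiE_mem[OF assms(2) that] unfolding decorated_graph_def by blast
  then show ?thesis
    unfolding weight_def
    by (intro mult_nonneg_nonneg prod_nonneg ballI) (use edge_factor_nonneg assms in blast)+
qed

text \<open>The indicators of the two endpoints merge into one condition on
  \<open>e \<inter> \<Theta>\<close>. The second identity has the shape \<open>z * x + 1\<close> so
  that the product over all edges can be expanded by \<open>prod_add\<close> into a sum over edge
  sets.\<close>

lemma edge_factor_reduced_TypeII: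
  assumes "decorated_graph K G" "e \<in> edges G" "\<phi> \<in> verts G \<rightarrow>\<^sub>E {1..K}"
  shows "edge_factor (reduced_graph TypeII G \<Theta> \<theta>) \<phi> e =
      edge_factor G \<phi> e * of_bool (\<forall>u\<in>e \<inter> \<Theta>. \<phi> u = \<theta> u)"
    and "edge_factor (interp_TypeII (reduced_graph TypeII G \<Theta> \<theta>) z) \<phi> e =
      z * of_real (edge_factor G \<phi> e * of_bool (\<forall>u\<in>e \<inter> \<Theta>. \<phi> u = \<theta> u) - 1) + 1"
proof -
  obtain u v where e: "e = {u, v}" "u \<noteq> v" "u \<in> verts G" "v \<in> verts G"
    using edgeE assms(1,2) .
  have c: "\<phi> u \<in> {1..K}" "\<phi> v \<in> {1..K}" using assms(3) e by (blast dest: PiE_mem)+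
  have sym: "amat G v u (\<phi> v) (\<phi> u) = amat G u v (\<phi> u) (\<phi> v)"
    using amat_swap[OF assms(1) _ c] assms(2) e by simp
  show "edge_factor (reduced_graph TypeII G \<Theta> \<theta>) \<phi> e =
      edge_factor G \<phi> e * of_bool (\<forall>u\<in>e \<inter> \<Theta>. \<phi> u = \<theta> u)"
    unfolding e(1)
    by (subst (1 2) edge_factor_doubleton) (auto simp: e(2) sym reduced_graph_def)
  show "edge_factor (interp_TypeII (reduced_graph TypeII G \<Theta> \<theta>) z) \<phi> e =
      z * of_real (edge_factor G \<phi> e * of_bool (\<forall>u\<in>e \<inter> \<Theta>. \<phi> u = \<theta> u) - 1) + 1"
    unfolding e(1)
    by (subst (1 2) edge_factor_doubleton)
       (auto simp: e(2) sym reduced_graph_def interp_TypeII_def)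
qed

text \<open>
  The nodes whose colour a reduced graph really prescribes: for Type II the prescription is void on
  isolated nodes.
\<close>

definition pinnable :: "interpolation \<Rightarrow> ('v, 'a) dgraph \<Rightarrow> 'v set" where
  "pinnable ty G = (case ty of TypeI \<Rightarrow> verts G | TypeII \<Rightarrow> \<Union>(edges G))"

lemma reduced_graph_simps [simp]:
  "verts (reduced_graph ty G \<Theta> \<theta>) = verts G"
  "edges (reduced_graph ty G \<Theta> \<theta>) = edges G"
  by (simp_all add: reduced_graph_def split: interpolation.split)

text \<open>For Type II each edge factor carries the indicators of its own endpoints, so the product
  over all edges pins exactly those nodes of \<open>\<Theta>\<close> that lie on some edge.\<close>

lemma weight_reduced_graph:
  assumes "decorated_graph K G" "\<Theta> \<subseteq> verts G" "\<phi> \<in> verts G \<rightarrow>\<^sub>E {1..K}"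
  shows "weight (reduced_graph ty G \<Theta> \<theta>) \<phi> =
    weight G \<phi> * of_bool (\<forall>u\<in>\<Theta> \<inter> pinnable ty G. \<phi> u = \<theta> u)"
proof (cases ty)
  case TypeI
  have "\<Theta> \<inter> verts G = \<Theta>" "finite (verts G)" using assms by (auto simp: decorated_graph_def)
  then show ?thesis
    using assms by (simp add: TypeI weight_reduced_TypeI pinnable_def)
next
  case TypeII
  have "(\<Prod>e\<in>edges G. of_bool (\<forall>u\<in>e \<inter> \<Theta>. \<phi> u = \<theta> u)) =
      (of_bool (\<forall>u\<in>\<Theta> \<inter> \<Union>(edges G). \<phi> u = \<theta> u) :: real)"
  proof (cases "\<forall>u\<in>\<Theta> \<inter> \<Union>(edges G). \<phi> u = \<theta> u")
    case False
    then obtain e where "e \<in> edges G" "\<not> (\<forall>u\<in>e \<inter> \<Theta>. \<phi> u = \<theta> u)" by blast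
    with False finite_edges[OF assms(1)] show ?thesis
      by (auto intro!: prod_zero)
  next
    case True
    then have "of_bool (\<forall>u\<in>e \<inter> \<Theta>. \<phi> u = \<theta> u) = (1 :: real)" if "e \<in> edges G" for e
      using that by auto
    then show ?thesis using True by simp
  qed
  then show ?thesis
    using edge_factor_reduced_TypeII(1)[OF assms(1) _ assms(3)]
    by (simp add: TypeII weight_def pinnable_def prod.distrib) (simp add: reduced_graph_def)
qed

subsection \<open>Additivity of the truncated expansions\<close>

text \<open>The contribution of \<open>I\<close> to the coefficient of order \<open>card I\<close>.
  It is set to zero for inadmissible \<open>I\<close>, so that the sum runs over all subsets of
  \<open>verts G\<close> whatever the pinning. An edge inside a subset of \<open>tilde_verts\<close>
  belongs to \<open>tilde_edges\<close>, hence independence may refer to all of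
  \<open>edges G\<close>.\<close>

definition coeff_TypeI :: "('v, real) dgraph \<Rightarrow> 'v set \<Rightarrow> ('v \<Rightarrow> nat) \<Rightarrow> 'v set \<Rightarrow> real" where
  "coeff_TypeI G \<Theta> \<theta> I =
     of_bool (I \<subseteq> tilde_verts G \<Theta> \<theta> \<and> (\<forall>e\<in>edges G. \<not> e \<subseteq> I)) *
     fugacity G ^ (card {u \<in> \<Theta>. \<theta> u = 2} + card I)"

text \<open>The contribution of \<open>F\<close> when the product of the factors
  \<open>1 + z * (A - 1)\<close> over all edges is multiplied out. Edges outside \<open>F\<close>
  contribute 1, so only the colours and pins on the endpoints of \<open>F\<close> are felt, apart
  from the node weights.\<close>

definition coeff_TypeII ::
  "nat \<Rightarrow> ('v, real) dgraph \<Rightarrow> 'v set \<Rightarrow> ('v \<Rightarrow> nat) \<Rightarrow> 'v set set \<Rightarrow> real" where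
  "coeff_TypeII K G \<Theta> \<theta> F = (\<Sum>\<phi>\<in>verts G \<rightarrow>\<^sub>E {1..K}. (\<Prod>u\<in>verts G. avec G u (\<phi> u)) *
     (\<Prod>e\<in>F. edge_factor G \<phi> e * of_bool (\<forall>u\<in>e \<inter> \<Theta>. \<phi> u = \<theta> u) - 1))"

lemma interp_Z_TypeI:
  assumes "decorated_graph K G"
  shows "interp_Z TypeI K G \<Theta> \<theta> z =
    (\<Sum>I\<in>Pow (verts G). of_real (coeff_TypeI G \<Theta> \<theta> I) * z ^ card I)"
proof -
  have sub: "tilde_verts G \<Theta> \<theta> \<subseteq> verts G" by (auto simp: tilde_verts_def)
  have eq: "indep_sets (tilde_verts G \<Theta> \<theta>) (tilde_edges G \<Theta> \<theta>) =
      {I \<in> Pow (verts G). I \<subseteq> tilde_verts G \<Theta> \<theta> \<and> (\<forall>e\<in>edges G. \<not> e \<subseteq> I)}"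
    using sub unfolding indep_sets_def tilde_edges_def by blast
  have fin: "finite (Pow (verts G))" using assms by (simp add: decorated_graph_def)
  show ?thesis
    unfolding interp_Z_def eq interpolation.case sum.inter_filter[OF fin] sum_distrib_left
    by (intro sum.cong) (auto simp: coeff_TypeI_def power_add power_mult_distrib)
qed

lemma interp_TypeII_simps:
  "verts (interp_TypeII (reduced_graph TypeII G \<Theta> \<theta>) z) = verts G"
  "edges (interp_TypeII (reduced_graph TypeII G \<Theta> \<theta>) z) = edges G"
  "avec (interp_TypeII (reduced_graph TypeII G \<Theta> \<theta>) z) u i = of_real (avec G u i)"
  by (simp_all add: interp_TypeII_def reduced_graph_def)

lemma interp_Z_TypeII:
  assumes "decorated_graph K G"
  shows "interp_Z TypeII K G \<Theta> \<theta> z =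
    (\<Sum>F\<in>Pow (edges G). of_real (coeff_TypeII K G \<Theta> \<theta> F) * z ^ card F)"
proof -
  define b where "b \<phi> e = edge_factor G \<phi> e * of_bool (\<forall>u\<in>e \<inter> \<Theta>. \<phi> u = \<theta> u) - 1" for \<phi> e
  have "interp_Z TypeII K G \<Theta> \<theta> z =
      (\<Sum>\<phi>\<in>verts G \<rightarrow>\<^sub>E {1..K}. (\<Prod>u\<in>verts G. of_real (avec G u (\<phi> u))) *
        (\<Prod>e\<in>edges G. z * of_real (b \<phi> e) + 1))"
    unfolding interp_Z_def interpolation.case partition_fun_def interp_TypeII_simps
  proof (rule sum.cong[OF refl])
    fix \<phi> assume "\<phi> \<in> verts G \<rightarrow>\<^sub>E {1..K}"
    then show "weight (interp_TypeII (reduced_graph TypeII G \<Theta> \<theta>) z) \<phi> =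
        (\<Prod>u\<in>verts G. of_real (avec G u (\<phi> u))) * (\<Prod>e\<in>edges G. z * of_real (b \<phi> e) + 1)"
      using edge_factor_reduced_TypeII(2)[OF assms] unfolding weight_def interp_TypeII_simps b_def
      by (intro arg_cong2[where f = "(*)"] prod.cong refl) auto
  qed
  also have "\<dots> = (\<Sum>\<phi>\<in>verts G \<rightarrow>\<^sub>E {1..K}. \<Sum>F\<in>Pow (edges G).
      of_real ((\<Prod>u\<in>verts G. avec G u (\<phi> u)) * (\<Prod>e\<in>F. b \<phi> e)) * z ^ card F)"
    unfolding prod_add[OF finite_edges[OF assms]] sum_distrib_left
    by (intro sum.cong) (auto simp: prod.distrib mult_ac)
  also have "\<dots> = (\<Sum>F\<in>Pow (edges G). of_real (coeff_TypeII K G \<Theta> \<theta> F) * z ^ card F)"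
    by (subst sum.swap) (simp add: coeff_TypeII_def b_def sum_distrib_right)
  finally show ?thesis .
qed

text \<open>No edge of \<open>F \<union> F'\<close> crosses the border of \<open>W\<close>. Colours
  and edges inside \<open>W\<close> are exchanged together. Inside \<open>W\<close> no node of
  \<open>T\<close> occurs, so the pins \<open>X \<union> S \<union> T\<close> and \<open>X\<close>
  act as \<open>X \<union> S\<close> and \<open>X \<union> T\<close>; outside \<open>W\<close> no
  node of \<open>S\<close> occurs, so they act as \<open>X \<union> T\<close> and
  \<open>X \<union> S\<close>. After the exchange each configuration therefore sees a single set of
  pins.\<close>

lemma coeff_TypeII_swap:
  assumes dg: "decorated_graph K G" and F: "F \<subseteq> edges G" "F' \<subseteq> edges G"
    and W: "\<And>e. e \<in> F \<union> F' \<Longrightarrow> e \<subseteq> W \<or> e \<inter> W = {}" "S \<subseteq> W" "T \<inter> W = {}"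
  defines "EW \<equiv> {e. e \<subseteq> W}"
  shows "coeff_TypeII K G (X \<union> S \<union> T) \<theta> F * coeff_TypeII K G X \<theta> F' =
    coeff_TypeII K G (X \<union> T) \<theta> (F - EW \<union> F' \<inter> EW) * coeff_TypeII K G (X \<union> S) \<theta> (F' - EW \<union> F \<inter> EW)"
  unfolding coeff_TypeII_def
proof (rule sum_mult_sum_override_on[where W = W])
  fix \<phi> \<psi> assume "\<phi> \<in> verts G \<rightarrow>\<^sub>E {1..K}" "\<psi> \<in> verts G \<rightarrow>\<^sub>E {1..K}"
  define \<phi>' where "\<phi>' = override_on \<phi> \<psi> W"
  define \<psi>' where "\<psi>' = override_on \<psi> \<phi> W"
  define b where "b \<Theta> \<phi> e = edge_factor G \<phi> e * of_bool (\<forall>u\<in>e \<inter> \<Theta>. \<phi> u = \<theta> u) - 1" for \<Theta> \<phi> e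
  \<comment> \<open>An edge term depends only on the colours and the pins at its own endpoints; this
    locality justifies each of the four regroupings below.\<close>
  have b_cong: "b \<Theta> \<phi> e = b \<Theta>' \<psi> e" if "e \<inter> \<Theta> = e \<inter> \<Theta>'" "\<And>u. u \<in> e \<Longrightarrow> \<phi> u = \<psi> u" for \<Theta> \<Theta>' \<phi> \<psi> e
    using edge_factor_cong[of e \<phi> \<psi> G, OF that(2)] that unfolding b_def by auto
  have fin: "finite F" "finite F'"
    using F finite_edges[OF dg] finite_subset by blast+
  have split: "prod f A = prod f (A - EW) * prod f (A \<inter> EW)" if "finite A" for f :: "_ \<Rightarrow> real" and A
    using prod.Int_Diff[OF that, of f EW] by (simp add: mult.commute)
  have union: "prod f (A - EW \<union> B \<inter> EW) = prod f (A - EW) * prod f (B \<inter> EW)"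
    if "finite A" "finite B" for f :: "_ \<Rightarrow> real" and A B
    using that by (intro prod.union_disjoint) auto
  have a: "(\<Prod>u\<in>verts G. avec G u (\<phi> u)) * (\<Prod>u\<in>verts G. avec G u (\<psi> u)) =
      (\<Prod>u\<in>verts G. avec G u (\<phi>' u)) * (\<Prod>u\<in>verts G. avec G u (\<psi>' u))"
    unfolding prod.distrib[symmetric] \<phi>'_def \<psi>'_def
    by (intro prod.cong) (auto simp: override_on_def)
  have off: "e \<inter> W = {}" if "e \<in> F - EW \<or> e \<in> F' - EW" for e
    using that W(1) by (auto simp: EW_def)
  have on: "e \<subseteq> W" if "e \<in> F \<inter> EW \<or> e \<in> F' \<inter> EW" for e
    using that by (auto simp: EW_def)
  have "prod (b (X \<union> S \<union> T) \<phi>) (F - EW) = prod (b (X \<union> T) \<phi>') (F - EW)"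
    by (intro prod.cong refl b_cong; drule disjI1[THEN off])
       (use W(2) in \<open>auto simp: \<phi>'_def override_on_def\<close>)
  moreover have "prod (b (X \<union> S \<union> T) \<phi>) (F \<inter> EW) = prod (b (X \<union> S) \<psi>') (F \<inter> EW)"
    by (intro prod.cong refl b_cong; drule disjI1[THEN on])
       (use W(3) in \<open>auto simp: \<psi>'_def override_on_def\<close>)
  moreover have "prod (b X \<psi>) (F' - EW) = prod (b (X \<union> S) \<psi>') (F' - EW)"
    by (intro prod.cong refl b_cong; drule disjI2[THEN off])
       (use W(2) in \<open>auto simp: \<psi>'_def override_on_def\<close>)
  moreover have "prod (b X \<psi>) (F' \<inter> EW) = prod (b (X \<union> T) \<phi>') (F' \<inter> EW)"
    by (intro prod.cong refl b_cong; drule disjI2[THEN on])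
       (use W(3) in \<open>auto simp: \<phi>'_def override_on_def\<close>)
  ultimately have "prod (b (X \<union> S \<union> T) \<phi>) F * prod (b X \<psi>) F' =
      prod (b (X \<union> T) \<phi>') (F - EW \<union> F' \<inter> EW) * prod (b (X \<union> S) \<psi>') (F' - EW \<union> F \<inter> EW)"
    unfolding union[OF fin] union[OF fin(2,1)] split[OF fin(1)] split[OF fin(2)] by simp
  with a show "(\<Prod>u\<in>verts G. avec G u (\<phi> u)) *
      (\<Prod>e\<in>F. edge_factor G \<phi> e * of_bool (\<forall>u\<in>e \<inter> (X \<union> S \<union> T). \<phi> u = \<theta> u) - 1) *
      ((\<Prod>u\<in>verts G. avec G u (\<psi> u)) *
      (\<Prod>e\<in>F'. edge_factor G \<psi> e * of_bool (\<forall>u\<in>e \<inter> X. \<psi> u = \<theta> u) - 1)) =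
      (\<Prod>u\<in>verts G. avec G u (override_on \<phi> \<psi> W u)) *
      (\<Prod>e\<in>F - EW \<union> F' \<inter> EW. edge_factor G (override_on \<phi> \<psi> W) e *
        of_bool (\<forall>u\<in>e \<inter> (X \<union> T). override_on \<phi> \<psi> W u = \<theta> u) - 1) *
      ((\<Prod>u\<in>verts G. avec G u (override_on \<psi> \<phi> W u)) *
      (\<Prod>e\<in>F' - EW \<union> F \<inter> EW. edge_factor G (override_on \<psi> \<phi> W) e *
        of_bool (\<forall>u\<in>e \<inter> (X \<union> S). override_on \<psi> \<phi> W u = \<theta> u) - 1))"
    unfolding b_def \<phi>'_def[symmetric] \<psi>'_def[symmetric] by (simp add: algebra_simps)
qed

text \<open>The counterpart for independent sets. A pinned node of colour 2 also removes its
  neighbours from \<open>tilde_verts\<close>, so the requirements on \<open>S\<close> and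
  \<open>T\<close> extend to nodes adjacent to them. The powers of the fugacity balance because the
  exchange preserves total cardinality and the pinned nodes of colour 2 obey
  inclusion-exclusion.\<close>

lemma coeff_TypeI_swap:
  assumes dg: "decorated_graph K G" and I: "I \<subseteq> verts G" "I' \<subseteq> verts G"
    and W: "\<And>e. e \<in> edges G \<Longrightarrow> e \<subseteq> I \<union> I' \<Longrightarrow> e \<subseteq> W \<or> e \<inter> W = {}"
    and S: "\<And>v. v \<in> I \<union> I' \<Longrightarrow> v \<in> S \<or> (\<exists>s\<in>S. {s, v} \<in> edges G) \<Longrightarrow> v \<in> W"
    and T: "\<And>v. v \<in> I \<union> I' \<Longrightarrow> v \<in> T \<or> (\<exists>t\<in>T. {t, v} \<in> edges G) \<Longrightarrow> v \<notin> W"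
    and fin: "finite X" "finite S" "finite T" and "S \<inter> T = {}"
  shows "coeff_TypeI G (X \<union> S \<union> T) \<theta> I * coeff_TypeI G X \<theta> I' =
    coeff_TypeI G (X \<union> T) \<theta> (I - W \<union> I' \<inter> W) * coeff_TypeI G (X \<union> S) \<theta> (I' - W \<union> I \<inter> W)"
proof -
  define J where "J = I - W \<union> I' \<inter> W"
  define J' where "J' = I' - W \<union> I \<inter> W"
  have ind: "(\<forall>e\<in>edges G. \<not> e \<subseteq> I) \<and> (\<forall>e\<in>edges G. \<not> e \<subseteq> I') \<longleftrightarrow>
      (\<forall>e\<in>edges G. \<not> e \<subseteq> J) \<and> (\<forall>e\<in>edges G. \<not> e \<subseteq> J')"
  proof -
    have "e \<subseteq> I \<or> e \<subseteq> I' \<longleftrightarrow> e \<subseteq> J \<or> e \<subseteq> J'" if "e \<in> edges G" for e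
    proof (cases "e \<subseteq> I \<union> I'")
      case True
      then consider "e \<subseteq> W" | "e \<inter> W = {}"
        using W \<open>e \<in> edges G\<close> by blast
      then show ?thesis
      proof cases
        case 1
        then have "e \<subseteq> J \<longleftrightarrow> e \<subseteq> I'" "e \<subseteq> J' \<longleftrightarrow> e \<subseteq> I" by (auto simp: J_def J'_def)
        then show ?thesis by blast
      next
        case 2
        then have "e \<subseteq> J \<longleftrightarrow> e \<subseteq> I" "e \<subseteq> J' \<longleftrightarrow> e \<subseteq> I'" by (auto simp: J_def J'_def)
        then show ?thesis by blast
      qed
    qed (auto simp: J_def J'_def)
    then have "(\<forall>e\<in>edges G. \<not> (e \<subseteq> I \<or> e \<subseteq> I')) \<longleftrightarrow> (\<forall>e\<in>edges G. \<not> (e \<subseteq> J \<or> e \<subseteq> J'))"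
      by simp
    then show ?thesis by (simp add: ball_conj_distrib)
  qed
  \<comment> \<open>Pinning \<open>S\<close> in addition changes \<open>tilde_verts\<close> only at
    \<open>S\<close> and its neighbours, and those that lie in \<open>I \<union> I'\<close> are in
    \<open>W\<close>. The same argument with \<open>T\<close> applies inside
    \<open>W\<close>.\<close>
  have tS: "v \<in> tilde_verts G (Y \<union> S) \<theta> \<longleftrightarrow> v \<in> tilde_verts G Y \<theta>" if "v \<in> I \<union> I'" "v \<notin> W" for v Y
    using S[OF that(1)] that(2) unfolding tilde_verts_def by blast
  have tT: "v \<in> tilde_verts G (Y \<union> T) \<theta> \<longleftrightarrow> v \<in> tilde_verts G Y \<theta>" if "v \<in> I \<union> I'" "v \<in> W" for v Y
    using T[OF that(1)] that(2) unfolding tilde_verts_def by blast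
  have tST: "v \<in> tilde_verts G (X \<union> S \<union> T) \<theta> \<longleftrightarrow> v \<in> tilde_verts G (X \<union> T) \<theta>"
    if "v \<in> I \<union> I'" "v \<notin> W" for v
    using tS[OF that, of "X \<union> T"] by (simp add: Un_ac)
  have til: "I \<subseteq> tilde_verts G (X \<union> S \<union> T) \<theta> \<and> I' \<subseteq> tilde_verts G X \<theta> \<longleftrightarrow>
      J \<subseteq> tilde_verts G (X \<union> T) \<theta> \<and> J' \<subseteq> tilde_verts G (X \<union> S) \<theta>"
    unfolding J_def J'_def subset_iff using tS[of _ X] tT[of _ X] tT[of _ "X \<union> S"] tST
    by (simp only: Un_iff Diff_iff Int_iff) blast
  have cI: "card I + card I' = card J + card J'"
    unfolding J_def J'_def using I dg
    by (subst card_swap) (auto simp: decorated_graph_def dest: finite_subset)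
  let ?C = "\<lambda>\<Theta>. {u \<in> \<Theta>. \<theta> u = 2}"
  \<comment> \<open>Inclusion-exclusion for the pinned nodes of colour 2: as \<open>S\<close> and
    \<open>T\<close> are disjoint, \<open>X \<union> T\<close> and \<open>X \<union> S\<close> meet
    exactly in \<open>X\<close>.\<close>
  have "card (?C (X \<union> T)) + card (?C (X \<union> S)) =
      card (?C (X \<union> T) \<union> ?C (X \<union> S)) + card (?C (X \<union> T) \<inter> ?C (X \<union> S))"
    using fin by (intro card_Un_Int) auto
  also have "?C (X \<union> T) \<union> ?C (X \<union> S) = ?C (X \<union> S \<union> T)" by blast
  also have "?C (X \<union> T) \<inter> ?C (X \<union> S) = ?C X" using \<open>S \<inter> T = {}\<close> by blast
  finally have cC: "card (?C (X \<union> S \<union> T)) + card (?C X) = card (?C (X \<union> T)) + card (?C (X \<union> S))"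
    by simp
  have pw: "fugacity G ^ (card (?C (X \<union> S \<union> T)) + card I) * fugacity G ^ (card (?C X) + card I') =
      fugacity G ^ (card (?C (X \<union> T)) + card J) * fugacity G ^ (card (?C (X \<union> S)) + card J')"
    unfolding power_add[symmetric] using cI cC by (intro arg_cong[where f = "power (fugacity G)"]) linarith
  have ob: "of_bool P * x * (of_bool Q * y) = of_bool (P \<and> Q) * (x * y)" for P Q and x y :: real
    by simp
  show ?thesis
    unfolding coeff_TypeI_def ob J_def[symmetric] J'_def[symmetric] pw
    by (intro arg_cong2[where f = "(*)"] arg_cong[where f = of_bool] refl) (use ind til in blast)
qed

section \<open>Agreement to low order for separated sets\<close>

lemma relpow_mono:
  fixes r r' :: "('a \<times> 'a) set"
  assumes "r \<subseteq> r'"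
  shows "r ^^ k \<subseteq> r' ^^ k"
  using assms by (induction k) (simp_all add: relcomp_mono)

text \<open>Distance at least \<open>R\<close>, phrased through walk lengths so that concrete walks
  can be tested against it without passing through \<open>enat\<close>.\<close>

definition separated :: "('v, 'a) dgraph \<Rightarrow> 'v set \<Rightarrow> 'v set \<Rightarrow> nat \<Rightarrow> bool" where
  "separated G S T R \<longleftrightarrow> (\<forall>s\<in>S. \<forall>t\<in>T. \<forall>k. (s, t) \<in> adj_rel G ^^ k \<longrightarrow> R \<le> k)"

text \<open>
  The bound \<open>2 * r + 2 \<le> R\<close> suffices for both types: \<open>k\<close> edges span at most \<open>2 * k\<close> nodes, and the
  pinning of a node in Type I also affects its neighbours.
\<close>

lemma fps_nth_coeff_TypeII:
  assumes dg: "decorated_graph K G" and sep: "separated G S T R" and "2 * r + 2 \<le> R" "k < r"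
  defines "P \<equiv> \<lambda>\<Theta> \<theta>. gen_fps (edges G) (coeff_TypeII K G \<Theta> \<theta>)"
  shows "fps_nth (P (X \<union> S \<union> T) \<theta> * P X \<theta>) k = fps_nth (P (X \<union> T) \<theta> * P (X \<union> S) \<theta>) k"
proof -
  define rel where "rel U = {(u, v). {u, v} \<in> U}" for U :: "'a set set"
  \<comment> \<open>The nodes that can be reached from \<open>S\<close> along edges of
    \<open>U\<close>; it contains \<open>S\<close> and is closed under these edges.\<close>
  define W where "W U = {v. \<exists>s\<in>S. (s, v) \<in> (rel U)\<^sup>*}" for U
  show ?thesis
    unfolding P_def
  proof (rule fps_nth_gen_fps_mult_swap[where W = "\<lambda>U. {e. e \<subseteq> W U}", OF finite_edges[OF dg] \<open>k < r\<close>])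
    fix A B assume AB: "A \<subseteq> edges G" "B \<subseteq> edges G" "card A + card B < r"
    let ?U = "A \<union> B"
    have finU: "finite ?U" using AB finite_edges[OF dg] finite_subset by blast
    have c2: "card e = 2" if "e \<in> ?U" for e
      using dg AB that by (auto simp: decorated_graph_def)
    have "card (\<Union>?U) \<le> (\<Sum>e\<in>?U. card e)" by (rule card_Union_le_sum_card)
    also have "\<dots> = 2 * card ?U" by (simp add: c2)
    also have "\<dots> < R" using card_Un_le[of A B] AB assms(3) by simp
    finally have cU: "card (\<Union>?U) < R" .
    have finUU: "finite (\<Union>?U)"
      using finU c2 by (metis card.infinite finite_Union zero_neq_numeral)
    show "coeff_TypeII K G (X \<union> S \<union> T) \<theta> A * coeff_TypeII K G X \<theta> B =
      coeff_TypeII K G (X \<union> T) \<theta> (A - {e. e \<subseteq> W ?U} \<union> B \<inter> {e. e \<subseteq> W ?U}) *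
      coeff_TypeII K G (X \<union> S) \<theta> (B - {e. e \<subseteq> W ?U} \<union> A \<inter> {e. e \<subseteq> W ?U})"
    proof (rule coeff_TypeII_swap[OF dg AB(1,2)])
      fix e assume e: "e \<in> A \<union> B"
      then obtain u v where uv: "e = {u, v}" using c2 by (metis card_2_iff)
      then have "(u, v) \<in> rel ?U" "(v, u) \<in> rel ?U"
        using e by (auto simp: rel_def insert_commute)
      then have "u \<in> W ?U \<longleftrightarrow> v \<in> W ?U"
        unfolding W_def by (auto intro: rtrancl_into_rtrancl)
      then show "e \<subseteq> W ?U \<or> e \<inter> W ?U = {}" using uv by auto
    next
      show "S \<subseteq> W ?U" by (auto simp: W_def)
      show "T \<inter> W ?U = {}"
      proof (rule ccontr)
        assume "T \<inter> W ?U \<noteq> {}"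
        then obtain s t where st: "s \<in> S" "t \<in> T" "(s, t) \<in> (rel ?U)\<^sup>*"
          by (auto simp: W_def)
        \<comment> \<open>A connection from \<open>S\<close> to \<open>T\<close> through
          \<open>?U\<close> could be shortened to at most as many steps as \<open>?U\<close> touches
          nodes. Fewer than \<open>r\<close> edges touch fewer than \<open>R\<close> nodes, which
          contradicts the separation.\<close>
        have "Range (rel ?U) \<subseteq> \<Union>?U" by (auto simp: rel_def)
        then obtain k where k: "k \<le> card (\<Union>?U)" "(s, t) \<in> rel ?U ^^ k"
          using relpow_le_card_Range[OF st(3) _ finUU] by blast
        have "rel ?U \<subseteq> adj_rel G" using AB by (auto simp: rel_def adj_rel_def)
        then have "(s, t) \<in> adj_rel G ^^ k" using k(2) relpow_mono by blast
        then show False using sep st cU k(1) unfolding separated_def by fastforce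
      qed
    qed
  qed
qed

lemma fps_nth_coeff_TypeI:
  assumes dg: "decorated_graph K G" and sep: "separated G S T R" and "2 * r + 2 \<le> R" "k < r"
    and sub: "X \<subseteq> verts G" "S \<subseteq> verts G" "T \<subseteq> verts G"
  defines "P \<equiv> \<lambda>\<Theta> \<theta>. gen_fps (verts G) (coeff_TypeI G \<Theta> \<theta>)"
  shows "fps_nth (P (X \<union> S \<union> T) \<theta> * P X \<theta>) k = fps_nth (P (X \<union> T) \<theta> * P (X \<union> S) \<theta>) k"
proof -
  have finV: "finite (verts G)" using dg by (simp add: decorated_graph_def)
  define rel where "rel U = {(u, v). {u, v} \<in> edges G \<and> u \<in> U \<and> v \<in> U}" for U
  \<comment> \<open>The closed neighbourhood of \<open>v\<close>. The region \<open>W U\<close> is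
    seeded with the nodes of \<open>U\<close> that belong to \<open>S\<close> or are adjacent to it,
    since these are the nodes affected by pinning \<open>S\<close>.\<close>
  define N where "N v = {s. s = v \<or> {s, v} \<in> edges G}" for v
  define W where "W U = {v. \<exists>s\<in>U. N s \<inter> S \<noteq> {} \<and> (s, v) \<in> (rel U)\<^sup>*}" for U
  have disj: "S \<inter> T = {}"
  proof (rule ccontr)
    assume "S \<inter> T \<noteq> {}"
    then obtain s where "s \<in> S" "s \<in> T" by blast
    then have "R \<le> 0"
      using sep unfolding separated_def by (metis pair_in_Id_conv relpow.simps(1))
    then show False using assms(3) by simp
  qed
  show ?thesis
    unfolding P_def
  proof (rule fps_nth_gen_fps_mult_swap[where W = W, OF finV \<open>k < r\<close>])
    fix A B assume AB: "A \<subseteq> verts G" "B \<subseteq> verts G" "card A + card B < r"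
    let ?U = "A \<union> B"
    have finU: "finite ?U" using AB finV finite_subset by blast
    have cU: "card ?U + 2 < R" using card_Un_le[of A B] AB assms(3) by simp
    show "coeff_TypeI G (X \<union> S \<union> T) \<theta> A * coeff_TypeI G X \<theta> B =
      coeff_TypeI G (X \<union> T) \<theta> (A - W ?U \<union> B \<inter> W ?U) * coeff_TypeI G (X \<union> S) \<theta> (B - W ?U \<union> A \<inter> W ?U)"
    proof (rule coeff_TypeI_swap[OF dg AB(1,2)])
      fix e assume e: "e \<in> edges G" "e \<subseteq> A \<union> B"
      then obtain u v where uv: "e = {u, v}" using edgeE[OF dg] by metis
      then have "(u, v) \<in> rel ?U" "(v, u) \<in> rel ?U"
        using e by (auto simp: rel_def insert_commute)
      then have "u \<in> W ?U \<longleftrightarrow> v \<in> W ?U"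
        unfolding W_def by (auto intro: rtrancl_into_rtrancl)
      then show "e \<subseteq> W ?U \<or> e \<inter> W ?U = {}" using uv by auto
    next
      fix v assume "v \<in> ?U" "v \<in> S \<or> (\<exists>s\<in>S. {s, v} \<in> edges G)"
      then show "v \<in> W ?U" by (auto simp: W_def N_def)
    next
      fix v assume v: "v \<in> ?U" "v \<in> T \<or> (\<exists>t\<in>T. {t, v} \<in> edges G)"
      show "v \<notin> W ?U"
      proof
        assume "v \<in> W ?U"
        then obtain s s' where s: "s' \<in> S" "s' = s \<or> {s', s} \<in> edges G" "(s, v) \<in> (rel ?U)\<^sup>*"
          by (auto simp: W_def N_def)
        obtain t where t: "t \<in> T" "v = t \<or> {v, t} \<in> edges G"
          using v(2) by (auto simp: insert_commute)
        have "Range (rel ?U) \<subseteq> ?U" by (auto simp: rel_def)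
        then obtain k where k: "k \<le> card ?U" "(s, v) \<in> rel ?U ^^ k"
          using relpow_le_card_Range[OF s(3) _ finU] by blast
        have "rel ?U \<subseteq> adj_rel G" by (auto simp: rel_def adj_rel_def)
        then have "(s, v) \<in> adj_rel G ^^ k" using k(2) relpow_mono by blast
        moreover obtain i where "i \<le> 1" "(s', s) \<in> adj_rel G ^^ i"
          using s(2) by (metis (no_types, lifting) adj_rel_def case_prodI le_refl mem_Collect_eq
              pair_in_Id_conv relpow.simps(1) relpow_1 zero_le)
        moreover obtain j where "j \<le> 1" "(v, t) \<in> adj_rel G ^^ j"
          using t(2) by (metis (no_types, lifting) adj_rel_def case_prodI le_refl mem_Collect_eq
              pair_in_Id_conv relpow.simps(1) relpow_1 zero_le)
        \<comment> \<open>The walk has at most one step from \<open>S\<close> into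
          \<open>?U\<close>, at most \<open>card ?U\<close> steps within \<open>?U\<close>, and at
          most one step on to \<open>T\<close>; the total is at most \<open>card ?U + 2\<close>,
          which is below \<open>R\<close>.\<close>
        ultimately have "(s', t) \<in> adj_rel G ^^ (i + k + j)" "i + k + j < R"
          using k(1) cU by (auto simp: relpow_add)
        then show False using sep s(1) t(1) unfolding separated_def by fastforce
      qed
    qed (use sub finV disj finite_subset in blast)+
  qed
qed

text \<open>The derivatives of the four logarithms at 0 satisfy the additive relation in each order
  below \<open>r\<close>, and \<open>m < real r\<close> keeps every term of the truncated sums below
  \<open>r\<close>. The two positivity assumptions ensure that the interpolation at
  \<open>z = 0\<close>, which is the coefficient of the empty set, is positive for every
  pinning.\<close>

lemma taylor_T_additive:
  assumes dg: "decorated_graph K G" and sep: "separated G S T R" and r: "2 * r + 2 \<le> R" "m < real r"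
    and sub: "X \<subseteq> verts G" "S \<subseteq> verts G" "T \<subseteq> verts G"
    and fugacity_pos: "ty = TypeI \<Longrightarrow> fugacity G > 0"
    and avec_pos: "ty = TypeII \<Longrightarrow> (\<Sum>\<phi>\<in>verts G \<rightarrow>\<^sub>E {1..K}. \<Prod>u\<in>verts G. avec G u (\<phi> u)) > 0"
  shows "taylor_T ty K G (X \<union> S \<union> T) \<theta> m z + taylor_T ty K G X \<theta> m z =
    taylor_T ty K G (X \<union> T) \<theta> m z + taylor_T ty K G (X \<union> S) \<theta> m z"
proof -
  let ?D = "\<lambda>\<Theta> k. (deriv ^^ k) (\<lambda>w. Ln (interp_Z ty K G \<Theta> \<theta> w)) 0"
  have D: "?D (X \<union> S \<union> T) k + ?D X k = ?D (X \<union> T) k + ?D (X \<union> S) k" if "k < r" for k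
  proof (cases ty)
    case TypeI
    have fin: "finite (verts G)" using dg by (simp add: decorated_graph_def)
    have "e \<noteq> {}" if "e \<in> edges G" for e using edgeE[OF dg that] by blast
    then have pos: "coeff_TypeI G \<Theta> \<theta> {} > 0" for \<Theta>
      using fugacity_pos[OF TypeI] by (auto simp: coeff_TypeI_def)
    show ?thesis
      unfolding TypeI interp_Z_TypeI[OF dg]
      by (rule higher_deriv_Ln_gen_fps_add_eq[where r = r])
         (rule fin pos that fps_nth_coeff_TypeI[OF dg sep r(1) _ sub] | assumption)+
  next
    case TypeII
    have fin: "finite (edges G)" using dg by (rule finite_edges)
    have pos: "coeff_TypeII K G \<Theta> \<theta> {} > 0" for \<Theta>
      using avec_pos[OF TypeII] by (simp add: coeff_TypeII_def)
    show ?thesis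
      unfolding TypeII interp_Z_TypeII[OF dg]
      by (rule higher_deriv_Ln_gen_fps_add_eq[where r = r])
         (rule fin pos that fps_nth_coeff_TypeII[OF dg sep r(1)] | assumption)+
  qed
  have "k < r" if "real k \<le> m" for k using that r(2) by linarith
  then show ?thesis
    unfolding taylor_T_def sum.distrib[symmetric] distrib_right[symmetric] add_divide_distrib[symmetric]
    by (intro sum.cong refl) (simp add: D)
qed

subsection \<open>Conditional and unconditional probabilities\<close>

text \<open>The Gibbs measure without normalisation. Partition functions of reduced graphs become
  masses of events in the single graph \<open>G\<close>, which makes different pinnings
  comparable.\<close>

definition mass :: "nat \<Rightarrow> ('v, real) dgraph \<Rightarrow> (('v \<Rightarrow> nat) \<Rightarrow> bool) \<Rightarrow> real" where
  "mass K G P = (\<Sum>\<phi>\<in>verts G \<rightarrow>\<^sub>E {1..K}. weight G \<phi> * of_bool (P \<phi>))"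

lemma finite_configs:
  assumes "decorated_graph K G"
  shows "finite (verts G \<rightarrow>\<^sub>E {1..K})"
  using assms by (intro finite_PiE) (auto simp: decorated_graph_def)

lemma mass_cong:
  assumes "\<And>\<phi>. \<phi> \<in> verts G \<rightarrow>\<^sub>E {1..K} \<Longrightarrow> P \<phi> \<longleftrightarrow> Q \<phi>"
  shows "mass K G P = mass K G Q"
  unfolding mass_def using assms by (intro sum.cong) auto

lemma partition_fun_eq_mass: "partition_fun K G = mass K G (\<lambda>_. True)"
  by (simp add: partition_fun_def mass_def)

lemma mass_reduced_graph:
  assumes "decorated_graph K G" "\<Lambda> \<subseteq> verts G"
  shows "mass K (reduced_graph ty G \<Lambda> \<eta>) P =
    mass K G (\<lambda>\<phi>. (\<forall>u\<in>\<Lambda> \<inter> pinnable ty G. \<phi> u = \<eta> u) \<and> P \<phi>)"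
  unfolding mass_def reduced_graph_simps
  using weight_reduced_graph[OF assms] by (intro sum.cong) auto

lemma mass_nonneg: "decorated_graph K G \<Longrightarrow> mass K G P \<ge> 0"
  unfolding mass_def by (intro sum_nonneg mult_nonneg_nonneg weight_nonneg) auto

lemma mass_mono:
  assumes "decorated_graph K G" "\<And>\<phi>. P \<phi> \<Longrightarrow> Q \<phi>"
  shows "mass K G P \<le> mass K G Q"
  unfolding mass_def
  by (intro sum_mono mult_left_mono) (auto simp: assms(2) weight_nonneg[OF assms(1)])

lemma mass_posE:
  assumes "mass K G P > 0"
  obtains \<phi> where "\<phi> \<in> verts G \<rightarrow>\<^sub>E {1..K}" "P \<phi>" "weight G \<phi> \<noteq> 0"
proof -
  have "\<exists>\<phi>\<in>verts G \<rightarrow>\<^sub>E {1..K}. weight G \<phi> * of_bool (P \<phi>) \<noteq> 0"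
    using assms unfolding mass_def by (metis (mono_tags, lifting) less_irrefl sum.neutral)
  then show ?thesis using that by auto
qed

lemma sum_mass_marginals:
  assumes "decorated_graph K G" "S \<subseteq> verts G"
  shows "(\<Sum>\<sigma>\<in>S \<rightarrow>\<^sub>E {1..K}. mass K G (\<lambda>\<phi>. (\<forall>u\<in>S. \<phi> u = \<sigma> u) \<and> Q \<phi>)) = mass K G Q"
proof -
  have finS: "finite (S \<rightarrow>\<^sub>E {1..K})"
    using assms by (intro finite_PiE) (auto simp: decorated_graph_def dest: finite_subset)
  have one: "(\<Sum>\<sigma>\<in>S \<rightarrow>\<^sub>E {1..K}. weight G \<phi> * of_bool ((\<forall>u\<in>S. \<phi> u = \<sigma> u) \<and> Q \<phi>)) = weight G \<phi> * of_bool (Q \<phi>)"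
    if "\<phi> \<in> verts G \<rightarrow>\<^sub>E {1..K}" for \<phi>
  proof -
    have "restrict \<phi> S \<in> S \<rightarrow>\<^sub>E {1..K}" using that assms(2) by auto
    moreover have "(\<forall>u\<in>S. \<phi> u = \<sigma> u) \<longleftrightarrow> \<sigma> = restrict \<phi> S" if "\<sigma> \<in> S \<rightarrow>\<^sub>E {1..K}" for \<sigma>
    proof
      assume "\<forall>u\<in>S. \<phi> u = \<sigma> u"
      then show "\<sigma> = restrict \<phi> S"
        using that by (intro extensionalityI[of _ S]) (auto simp: PiE_iff)
    qed simp
    then have "(\<Sum>\<sigma>\<in>S \<rightarrow>\<^sub>E {1..K}. weight G \<phi> * of_bool ((\<forall>u\<in>S. \<phi> u = \<sigma> u) \<and> Q \<phi>)) =
        (\<Sum>\<sigma>\<in>S \<rightarrow>\<^sub>E {1..K}. if \<sigma> = restrict \<phi> S then weight G \<phi> * of_bool (Q \<phi>) else 0)"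
      by (intro sum.cong) auto
    ultimately show ?thesis
      using finS by (simp add: sum.delta)
  qed
  show ?thesis
    unfolding mass_def by (subst sum.swap) (intro sum.cong refl one)
qed

lemma gibbs_prob_eq_mass:
  assumes "finite (verts G)"
  shows "gibbs_prob K G P = mass K G P / partition_fun K G"
proof -
  have fin: "finite (verts G \<rightarrow>\<^sub>E {1..K})" using assms by (intro finite_PiE) auto
  have "{\<phi>. \<phi> \<in> verts G \<rightarrow>\<^sub>E {1..K} \<and> P \<phi>} = {\<phi> \<in> verts G \<rightarrow>\<^sub>E {1..K}. P \<phi>}" by blast
  then show ?thesis
    unfolding gibbs_prob_def mass_def gibbs_def sum_divide_distrib
    by (simp only: sum.inter_filter[OF fin]) (intro sum.cong, auto)
qed

text \<open>Only the values of the pinning on \<open>\<Theta>\<close> matter. Hence one pinning can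
  be used for several sets \<open>\<Theta>\<close>, although the approximation hypothesis speaks of
  extensional functions on each of them.\<close>

lemma reduced_graph_restrict:
  "reduced_graph ty G \<Theta> (restrict \<theta> \<Theta>) = reduced_graph ty G \<Theta> \<theta>"
  unfolding reduced_graph_def
  by (cases ty) (auto intro!: arg_cong[where f = "\<lambda>a. G\<lparr>avec := a\<rparr>"] arg_cong[where f = "\<lambda>a. G\<lparr>amat := a\<rparr>"]
      simp: fun_eq_iff of_bool_def)

lemma taylor_T_restrict:
  "taylor_T ty K G \<Theta> (restrict \<theta> \<Theta>) m z = taylor_T ty K G \<Theta> \<theta> m z"
proof -
  have "tilde_verts G \<Theta> (restrict \<theta> \<Theta>) = tilde_verts G \<Theta> \<theta>"
    by (auto simp: tilde_verts_def)
  moreover have "{u \<in> \<Theta>. restrict \<theta> \<Theta> u = 2} = {u \<in> \<Theta>. \<theta> u = 2}"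
    by auto
  ultimately have "interp_Z ty K G \<Theta> (restrict \<theta> \<Theta>) = interp_Z ty K G \<Theta> \<theta>"
    by (intro ext) (simp only: interp_Z_def tilde_edges_def reduced_graph_restrict)
  then show ?thesis by (simp add: taylor_T_def)
qed

definition taylor_approx ::
  "real \<Rightarrow> interpolation \<Rightarrow> nat \<Rightarrow> ('v, real) dgraph \<Rightarrow> real \<Rightarrow> 'v set \<Rightarrow> ('v \<Rightarrow> nat) \<Rightarrow> bool" where
  "taylor_approx \<epsilon> ty K G m \<Theta> \<theta> \<longleftrightarrow>
     (1 - \<epsilon>) * partition_fun K (reduced_graph ty G \<Theta> \<theta>) \<le> exp (Re (taylor_T ty K G \<Theta> \<theta> m 1)) \<and>
     exp (Re (taylor_T ty K G \<Theta> \<theta> m 1)) \<le> (1 + \<epsilon>) * partition_fun K (reduced_graph ty G \<Theta> \<theta>)"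

text \<open>
  Comparing with the unconditional probability, rather than with a second boundary condition,
  covers the configurations \<open>\<sigma>\<close> of vanishing conditional probability, to which the
  approximation hypothesis does not apply.
\<close>

lemma abs_gibbs_cond_diff_marginal_le:
  fixes G :: "('v, real) dgraph"
  assumes dg: "decorated_graph K G"
    and sub: "\<Lambda> \<subseteq> verts G" "S \<subseteq> verts G \<inter> pinnable ty G" "T \<subseteq> verts G \<inter> pinnable ty G"
    and \<eta>: "\<eta> \<in> \<Lambda> \<rightarrow> {1..K}" and \<epsilon>: "0 < \<epsilon>" "\<epsilon> < 1"
    and approx: "\<And>\<Theta> \<theta>. \<Theta> \<subseteq> verts G \<Longrightarrow> \<theta> \<in> \<Theta> \<rightarrow> {1..K} \<Longrightarrow>
      partition_fun K (reduced_graph ty G \<Theta> \<theta>) \<noteq> 0 \<Longrightarrow> taylor_approx \<epsilon> ty K G m \<Theta> \<theta>"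
    and additive: "\<And>\<theta>. taylor_T ty K G (\<Lambda> \<union> S \<union> T) \<theta> m 1 + taylor_T ty K G \<Lambda> \<theta> m 1 =
      taylor_T ty K G (\<Lambda> \<union> T) \<theta> m 1 + taylor_T ty K G (\<Lambda> \<union> S) \<theta> m 1"
    and pos: "gibbs_marginal K (reduced_graph ty G \<Lambda> \<eta>) T \<tau> > 0"
    and \<sigma>: "\<sigma> \<in> S \<rightarrow>\<^sub>E {1..K}"
  shows "\<bar>gibbs_cond K (reduced_graph ty G \<Lambda> \<eta>) S \<sigma> T \<tau> -
    gibbs_marginal K (reduced_graph ty G \<Lambda> \<eta>) S \<sigma>\<bar> \<le> ((1 + \<epsilon>) / (1 - \<epsilon>))\<^sup>2 - 1"
proof -
  let ?H = "reduced_graph ty G \<Lambda> \<eta>"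
  define pin where "pin = pinnable ty G"
  define M where "M P = mass K G (\<lambda>\<phi>. (\<forall>u\<in>\<Lambda> \<inter> pin. \<phi> u = \<eta> u) \<and> P \<phi>)" for P
  have finV: "finite (verts G)" using dg by (simp add: decorated_graph_def)
  have massH: "mass K ?H P = M P" for P
    unfolding M_def pin_def by (rule mass_reduced_graph[OF dg sub(1)])
  have gp: "gibbs_prob K ?H P = M P / M (\<lambda>_. True)" for P
    using gibbs_prob_eq_mass[of ?H K P] finV by (simp add: massH partition_fun_eq_mass)
  have Mnn: "M P \<ge> 0" for P unfolding M_def by (rule mass_nonneg[OF dg])
  have Mmono: "M P \<le> M Q" if "\<And>\<phi>. P \<phi> \<Longrightarrow> Q \<phi>" for P Q
    unfolding M_def by (rule mass_mono[OF dg]) (use that in auto)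
  define on where "on U \<zeta> \<phi> \<longleftrightarrow> (\<forall>u\<in>U. \<phi> u = \<zeta> u)" for U :: "'v set" and \<zeta> \<phi> :: "'v \<Rightarrow> nat"
  have Z00: "M (\<lambda>_. True) > 0" and Z01: "M (on T \<tau>) > 0"
    using pos Mnn[of "\<lambda>_. True"] Mnn[of "on T \<tau>"]
    unfolding gibbs_marginal_def gp on_def[abs_def] by (auto simp: zero_less_divide_iff)
  define p where "p \<sigma> = M (\<lambda>\<phi>. on S \<sigma> \<phi> \<and> on T \<tau> \<phi>) / M (on T \<tau>)" for \<sigma>
  define q where "q \<sigma> = M (on S \<sigma>) / M (\<lambda>_. True)" for \<sigma>
  have cond: "gibbs_cond K ?H S \<sigma> T \<tau> = p \<sigma>" for \<sigma>
    using Z00 unfolding gibbs_cond_def gibbs_marginal_def gp p_def on_def[abs_def] by simp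
  have marg: "gibbs_marginal K ?H S \<sigma> = q \<sigma>" for \<sigma>
    unfolding gibbs_marginal_def gp q_def on_def[abs_def] ..
  \<comment> \<open>Two products of two partition functions are compared through their
    approximations; each of the two factors costs
    \<open>(1 + \<epsilon>) / (1 - \<epsilon>)\<close>.\<close>
  define c where "c = ((1 + \<epsilon>) / (1 - \<epsilon>))\<^sup>2"
  have ratio: "p \<sigma> \<le> c * q \<sigma> \<and> q \<sigma> \<le> c * p \<sigma>" if "p \<sigma> > 0" for \<sigma>
  proof -
    have Z11: "M (\<lambda>\<phi>. on S \<sigma> \<phi> \<and> on T \<tau> \<phi>) > 0"
      using that Z01 by (simp add: p_def zero_less_divide_iff)
    then have Z10: "M (on S \<sigma>) > 0"
      using Mmono[of "\<lambda>\<phi>. on S \<sigma> \<phi> \<and> on T \<tau> \<phi>" "on S \<sigma>"] by auto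
    obtain \<phi> where \<phi>: "\<phi> \<in> verts G \<rightarrow>\<^sub>E {1..K}"
        "(\<forall>u\<in>\<Lambda> \<inter> pin. \<phi> u = \<eta> u) \<and> on S \<sigma> \<phi> \<and> on T \<tau> \<phi>" "weight G \<phi> \<noteq> 0"
      by (rule mass_posE[OF Z11[unfolded M_def]])
    \<comment> \<open>The configuration \<open>\<phi>\<close> of nonzero weight shows that the three
      prescriptions are compatible, so one pinning extends them all. It also guarantees that the
      colours on \<open>S \<union> T\<close> lie in \<open>{1..K}\<close>.\<close>
    define \<theta> where "\<theta> = override_on \<eta> \<phi> (S \<union> T)"
    have \<theta>_\<Lambda>: "\<theta> u = \<eta> u" if "u \<in> \<Lambda> \<inter> pin" for u
      using that \<phi>(2) by (simp add: \<theta>_def override_on_def)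
    have \<theta>_S: "\<theta> u = \<sigma> u" if "u \<in> S" for u
      using that \<phi>(2) by (simp add: \<theta>_def on_def)
    have \<theta>_T: "\<theta> u = \<tau> u" if "u \<in> T" for u
      using that \<phi>(2) by (simp add: \<theta>_def on_def)
    have \<theta>: "\<theta> \<in> (\<Lambda> \<union> S \<union> T) \<rightarrow> {1..K}"
      using \<eta> PiE_mem[OF \<phi>(1)] sub unfolding \<theta>_def override_on_def Pi_def by auto
    let ?Z = "\<lambda>\<Theta>. partition_fun K (reduced_graph ty G \<Theta> \<theta>)"
    have Z: "?Z \<Theta> = mass K G (\<lambda>\<phi>. \<forall>u\<in>\<Theta> \<inter> pin. \<phi> u = \<theta> u)" if "\<Theta> \<subseteq> verts G" for \<Theta>
      unfolding partition_fun_eq_mass mass_reduced_graph[OF dg that] pin_def by simp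
    \<comment> \<open>Since \<open>S\<close> and \<open>T\<close> lie in \<open>pinnable\<close>,
      pinning them takes full effect, and the four partition functions are the masses that occur in
      \<open>p\<close> and \<open>q\<close>.\<close>
    have Zs: "?Z (\<Lambda> \<union> S \<union> T) = M (\<lambda>\<phi>. on S \<sigma> \<phi> \<and> on T \<tau> \<phi>)"
        "?Z (\<Lambda> \<union> S) = M (on S \<sigma>)" "?Z (\<Lambda> \<union> T) = M (on T \<tau>)" "?Z \<Lambda> = M (\<lambda>_. True)"
      using sub \<theta>_\<Lambda> \<theta>_S \<theta>_T
      by (subst Z; auto simp: M_def on_def pin_def intro!: mass_cong)+
    let ?e = "\<lambda>\<Theta>. exp (Re (taylor_T ty K G \<Theta> \<theta> m 1))"
    have ap: "(1 - \<epsilon>) * ?Z \<Theta> \<le> ?e \<Theta>" "?e \<Theta> \<le> (1 + \<epsilon>) * ?Z \<Theta>"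
      if "\<Theta> \<subseteq> \<Lambda> \<union> S \<union> T" "?Z \<Theta> > 0" for \<Theta>
    proof -
      have "\<Theta> \<subseteq> verts G" "\<theta> \<in> \<Theta> \<rightarrow> {1..K}" using that(1) \<theta> sub by blast+
      then show "(1 - \<epsilon>) * ?Z \<Theta> \<le> ?e \<Theta>" "?e \<Theta> \<le> (1 + \<epsilon>) * ?Z \<Theta>"
        using approx[of \<Theta> \<theta>] that(2) unfolding taylor_approx_def by auto
    qed
    note ap11 = ap[of "\<Lambda> \<union> S \<union> T", unfolded Zs, OF order_refl Z11]
    note ap10 = ap[of "\<Lambda> \<union> S", unfolded Zs, OF _ Z10]
    note ap01 = ap[of "\<Lambda> \<union> T", unfolded Zs, OF _ Z01]
    note ap00 = ap[of "\<Lambda>", unfolded Zs, OF _ Z00]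
    \<comment> \<open>Additivity of the expansions, exponentiated: the approximations satisfy
      exactly the product rule that the masses satisfy only approximately.\<close>
    have e: "?e (\<Lambda> \<union> S \<union> T) * ?e \<Lambda> = ?e (\<Lambda> \<union> T) * ?e (\<Lambda> \<union> S)"
      unfolding exp_add[symmetric] plus_complex.sel[symmetric] additive ..
    let ?Z11 = "M (\<lambda>\<phi>. on S \<sigma> \<phi> \<and> on T \<tau> \<phi>)" and ?Z10 = "M (on S \<sigma>)"
      and ?Z01 = "M (on T \<tau>)" and ?Z00 = "M (\<lambda>_. True)"
    have "((1 - \<epsilon>) * ?Z11) * ((1 - \<epsilon>) * ?Z00) \<le> ?e (\<Lambda> \<union> S \<union> T) * ?e \<Lambda>"
      using ap11 ap00 Z11 Z00 \<epsilon> by (intro mult_mono) auto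
    also have "\<dots> \<le> ((1 + \<epsilon>) * ?Z01) * ((1 + \<epsilon>) * ?Z10)"
      unfolding e using ap10 ap01 Z10 Z01 \<epsilon> by (intro mult_mono) auto
    finally have 1: "(1 - \<epsilon>)\<^sup>2 * (?Z11 * ?Z00) \<le> (1 + \<epsilon>)\<^sup>2 * (?Z10 * ?Z01)"
      by (simp add: power2_eq_square mult_ac)
    have "((1 - \<epsilon>) * ?Z01) * ((1 - \<epsilon>) * ?Z10) \<le> ?e (\<Lambda> \<union> T) * ?e (\<Lambda> \<union> S)"
      using ap10 ap01 Z10 Z01 \<epsilon> by (intro mult_mono) auto
    also have "\<dots> \<le> ((1 + \<epsilon>) * ?Z11) * ((1 + \<epsilon>) * ?Z00)"
      unfolding e[symmetric] using ap11 ap00 Z11 Z00 \<epsilon> by (intro mult_mono) auto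
    finally have 2: "(1 - \<epsilon>)\<^sup>2 * (?Z10 * ?Z01) \<le> (1 + \<epsilon>)\<^sup>2 * (?Z11 * ?Z00)"
      by (simp add: power2_eq_square mult_ac)
    have pe: "(1 - \<epsilon>)\<^sup>2 > 0" using \<epsilon> by simp
    have "?Z11 * ?Z00 \<le> c * (?Z10 * ?Z01)" "?Z10 * ?Z01 \<le> c * (?Z11 * ?Z00)"
      using 1 2 pe unfolding c_def power_divide by (simp_all add: pos_le_divide_eq mult.commute)
    then show ?thesis
      using Z00 Z01 unfolding p_def q_def by (simp add: field_simps)
  qed
  have c1: "c \<ge> 1"
    unfolding c_def using \<epsilon> by (intro one_le_power) simp
  show ?thesis
    unfolding cond marg c_def[symmetric]
  proof (rule abs_diff_le_of_ratio_bounds[where A = "S \<rightarrow>\<^sub>E {1..K}"])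
    show "finite (S \<rightarrow>\<^sub>E {1..K})"
      using sub(2) finV by (intro finite_PiE) (auto dest: finite_subset)
    have SV: "S \<subseteq> verts ?H" using sub by simp
    have sumM: "(\<Sum>\<sigma>\<in>S \<rightarrow>\<^sub>E {1..K}. M (\<lambda>\<phi>. on S \<sigma> \<phi> \<and> Q \<phi>)) = M Q" for Q
    proof -
      have "M (\<lambda>\<phi>. on S \<sigma> \<phi> \<and> Q \<phi>) =
          mass K G (\<lambda>\<phi>. (\<forall>u\<in>S. \<phi> u = \<sigma> u) \<and> (\<forall>u\<in>\<Lambda> \<inter> pin. \<phi> u = \<eta> u) \<and> Q \<phi>)" for \<sigma>
        unfolding M_def on_def by (rule mass_cong) blast
      then show ?thesis
        using sum_mass_marginals[OF dg, of S] sub(2) by (simp add: M_def)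
    qed
    show "sum p (S \<rightarrow>\<^sub>E {1..K}) = 1"
      using sumM[of "on T \<tau>"] Z01 by (simp add: p_def flip: sum_divide_distrib)
    show "sum q (S \<rightarrow>\<^sub>E {1..K}) = 1"
      using sumM[of "\<lambda>_. True"] Z00 by (simp add: q_def flip: sum_divide_distrib)
    show "0 \<le> p \<sigma>" "0 \<le> q \<sigma>" for \<sigma>
      by (simp_all add: p_def q_def Mnn)
  qed (use ratio c1 \<sigma> in auto)
qed

section \<open>Spheres, isolated nodes and the range dependence\<close>

lemma gboundary_separated:
  assumes "S' \<subseteq> S" "R \<ge> 1"
  shows "separated G S' (gboundary G S R) R"
  unfolding separated_def
proof (intro ballI allI impI)
  fix s t k assume s: "s \<in> S'" and t: "t \<in> gboundary G S R" and k: "(s, t) \<in> adj_rel G ^^ k"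
  have "graph_dist G s t \<le> enat k"
    unfolding graph_dist_def by (rule INF_lower) (use k in simp)
  moreover have "\<not> graph_dist G s t \<le> enat (R - 1)"
    using s t assms(1) by (auto simp: gboundary_def gball_def)
  ultimately have "\<not> k \<le> R - 1"
    using order_trans[of "graph_dist G s t" "enat k" "enat (R - 1)"] by auto
  then show "R \<le> k" by simp
qed

text \<open>A boundary node is joined to \<open>S\<close> by a walk of positive length, and the last
  step of that walk is an edge containing it. So pinning the boundary is effective for Type II as
  well.\<close>

lemma gboundary_subset_pinnable:
  fixes G :: "('v, real) dgraph"
  assumes "R \<ge> 1"
  shows "gboundary G S R \<subseteq> verts G \<inter> pinnable ty G"
proof
  fix t assume t: "t \<in> gboundary G S R"
  then have tV: "t \<in> verts G" by (simp add: gboundary_def gball_def)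
  obtain s where s: "s \<in> S" "graph_dist G s t \<le> enat R"
    using t by (auto simp: gboundary_def gball_def)
  have "t \<in> \<Union>(edges G)"
  proof -
    have "\<exists>k. (s, t) \<in> adj_rel G ^^ k"
    proof (rule ccontr)
      assume "\<nexists>k. (s, t) \<in> adj_rel G ^^ k"
      then have "graph_dist G s t = \<infinity>"
        unfolding graph_dist_def by (simp add: top_enat_def)
      then show False using s(2) by simp
    qed
    then obtain k where k: "(s, t) \<in> adj_rel G ^^ k" by blast
    have "R \<le> k"
      using gboundary_separated[OF order_refl assms, unfolded separated_def, rule_format, OF s(1) t k] .
    then obtain j where "k = Suc j" using assms by (cases k) auto
    then obtain u where "(u, t) \<in> adj_rel G" using k by auto
    then show ?thesis by (auto simp: adj_rel_def)
  qed
  with tV show "t \<in> verts G \<inter> pinnable ty G"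
    by (cases ty) (auto simp: pinnable_def)
qed

lemma gibbs_cond_restrict: "gibbs_cond K G S (restrict \<sigma> S) T \<tau> = gibbs_cond K G S \<sigma> T \<tau>"
proof -
  have "(\<lambda>\<phi>. (\<forall>u\<in>S. \<phi> u = restrict \<sigma> S u) \<and> (\<forall>v\<in>T. \<phi> v = \<tau> v)) =
        (\<lambda>\<phi>. (\<forall>u\<in>S. \<phi> u = \<sigma> u) \<and> (\<forall>v\<in>T. \<phi> v = \<tau> v))"
    by (auto simp: fun_eq_iff)
  then show ?thesis by (simp only: gibbs_cond_def)
qed

text \<open>Proved by swapping the colours of \<open>J\<close> between two configurations.\<close>

lemma mass_split_isolated:
  assumes J: "\<And>e. e \<in> edges G \<Longrightarrow> e \<inter> J = {}"
    and Q: "\<And>\<phi> \<psi>. (\<And>u. u \<notin> J \<Longrightarrow> \<phi> u = \<psi> u) \<Longrightarrow> Q \<phi> \<longleftrightarrow> Q \<psi>"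
    and Q': "\<And>\<phi> \<psi>. (\<And>u. u \<notin> J \<Longrightarrow> \<phi> u = \<psi> u) \<Longrightarrow> Q' \<phi> \<longleftrightarrow> Q' \<psi>"
  shows "mass K G (\<lambda>\<phi>. (\<forall>u\<in>J. \<phi> u = \<sigma> u) \<and> Q \<phi>) * mass K G Q' =
    mass K G Q * mass K G (\<lambda>\<phi>. (\<forall>u\<in>J. \<phi> u = \<sigma> u) \<and> Q' \<phi>)"
  unfolding mass_def
proof (rule sum_mult_sum_override_on[where W = J])
  fix \<phi> \<psi> :: "'a \<Rightarrow> nat"
  let ?\<phi> = "override_on \<phi> \<psi> J" and ?\<psi> = "override_on \<psi> \<phi> J"
  have "(\<Prod>u\<in>verts G. avec G u (\<phi> u)) * (\<Prod>u\<in>verts G. avec G u (\<psi> u)) =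
      (\<Prod>u\<in>verts G. avec G u (?\<phi> u)) * (\<Prod>u\<in>verts G. avec G u (?\<psi> u))"
    unfolding prod.distrib[symmetric] by (intro prod.cong) (auto simp: override_on_def)
  moreover have "(\<Prod>e\<in>edges G. edge_factor G \<phi> e) = (\<Prod>e\<in>edges G. edge_factor G ?\<phi> e)"
    "(\<Prod>e\<in>edges G. edge_factor G \<psi> e) = (\<Prod>e\<in>edges G. edge_factor G ?\<psi> e)"
    using J by (intro prod.cong refl edge_factor_cong; fastforce simp: override_on_def)+
  ultimately have w: "weight G \<phi> * weight G \<psi> = weight G ?\<phi> * weight G ?\<psi>"
    unfolding weight_def by (simp add: algebra_simps)
  have "Q ?\<phi> \<longleftrightarrow> Q \<phi>" "Q' ?\<psi> \<longleftrightarrow> Q' \<psi>"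
    by (auto intro!: Q Q')
  moreover have "(\<forall>u\<in>J. ?\<psi> u = \<sigma> u) \<longleftrightarrow> (\<forall>u\<in>J. \<phi> u = \<sigma> u)"
    by auto
  ultimately show "weight G \<phi> * of_bool ((\<forall>u\<in>J. \<phi> u = \<sigma> u) \<and> Q \<phi>) * (weight G \<psi> * of_bool (Q' \<psi>)) =
      weight G ?\<phi> * of_bool (Q ?\<phi>) * (weight G ?\<psi> * of_bool ((\<forall>u\<in>J. ?\<psi> u = \<sigma> u) \<and> Q' ?\<psi>))"
    using w by simp
qed

text \<open>Nodes of \<open>S\<close> outside \<open>pinnable\<close> lie on no edge and are not
  really pinned by \<open>\<eta>\<close>, so their colours are independent of all others. They
  contribute the probability \<open>p\<close> of their prescribed colours, and this factor is the
  same for every boundary condition \<open>\<tau>\<close>.\<close>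

lemma gibbs_cond_isolated:
  fixes ty :: interpolation and G :: "('v, real) dgraph" and \<eta> :: "'v \<Rightarrow> nat"
  assumes dg: "decorated_graph K G"
    and sub: "\<Lambda> \<subseteq> verts G" "S \<subseteq> verts G" "T \<subseteq> pinnable ty G"
  defines "H \<equiv> reduced_graph ty G \<Lambda> \<eta>"
  assumes Z: "partition_fun K H \<noteq> 0"
  obtains p where "0 \<le> p" "p \<le> 1"
    "\<And>\<tau>. gibbs_cond K H S \<sigma> T \<tau> = p * gibbs_cond K H (S \<inter> pinnable ty G) \<sigma> T \<tau>"
proof -
  define pin where "pin = pinnable ty G"
  define J where "J = S - pin"
  define B where "B \<phi> \<longleftrightarrow> (\<forall>u\<in>\<Lambda> \<inter> pin. \<phi> u = \<eta> u)" for \<phi>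
  define JB where "JB \<phi> \<longleftrightarrow> (\<forall>u\<in>J. \<phi> u = \<sigma> u) \<and> B \<phi>" for \<phi>
  have finV: "finite (verts G)" using dg by (simp add: decorated_graph_def)
  have massH: "mass K H P = mass K G (\<lambda>\<phi>. B \<phi> \<and> P \<phi>)" for P
    unfolding B_def pin_def H_def by (rule mass_reduced_graph[OF dg sub(1)])
  have gp: "gibbs_prob K H P = mass K G (\<lambda>\<phi>. B \<phi> \<and> P \<phi>) / mass K G B" for P
    using gibbs_prob_eq_mass[of H K P] finV unfolding massH partition_fun_eq_mass by (simp add: H_def)
  have B_nz: "mass K G B \<noteq> 0" using Z by (simp add: massH partition_fun_eq_mass)
  then have B_pos: "mass K G B > 0" using mass_nonneg[OF dg, of B] by simp
  have J_edges: "e \<inter> J = {}" if "e \<in> edges G" for e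
    using that sub(2) by (cases ty) (auto simp: J_def pin_def pinnable_def)
  define p where "p = mass K G JB / mass K G B"
  show thesis
  proof (rule that[of p])
    show "0 \<le> p" unfolding p_def using mass_nonneg[OF dg] by simp
    show "p \<le> 1" unfolding p_def using B_pos mass_mono[OF dg, of JB B] by (simp add: JB_def)
  next
    fix \<tau>
    define Q where "Q \<phi> \<longleftrightarrow> B \<phi> \<and> (\<forall>u\<in>S \<inter> pin. \<phi> u = \<sigma> u) \<and> (\<forall>v\<in>T. \<phi> v = \<tau> v)" for \<phi>
    have eq: "(B \<phi> \<and> (\<forall>u\<in>S. \<phi> u = \<sigma> u) \<and> (\<forall>v\<in>T. \<phi> v = \<tau> v)) \<longleftrightarrow> (\<forall>u\<in>J. \<phi> u = \<sigma> u) \<and> Q \<phi>" for \<phi>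
      unfolding Q_def J_def by blast
    have "mass K G (\<lambda>\<phi>. (\<forall>u\<in>J. \<phi> u = \<sigma> u) \<and> Q \<phi>) * mass K G B = mass K G Q * mass K G JB"
      unfolding JB_def
    proof (rule mass_split_isolated[OF J_edges])
      fix \<phi> \<psi> :: "'v \<Rightarrow> nat" assume a: "\<And>u. u \<notin> J \<Longrightarrow> \<phi> u = \<psi> u"
      have pin: "\<phi> u = \<psi> u" if "u \<in> pin" for u using that a by (auto simp: J_def)
      then show "B \<phi> \<longleftrightarrow> B \<psi>" by (simp add: B_def)
      with pin show "Q \<phi> \<longleftrightarrow> Q \<psi>" using sub(3) by (auto simp: Q_def pin_def subset_iff)
    qed
    then have "mass K G (\<lambda>\<phi>. (\<forall>u\<in>J. \<phi> u = \<sigma> u) \<and> Q \<phi>) = p * mass K G Q"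
      using B_nz by (simp add: p_def field_simps)
    then show "gibbs_cond K H S \<sigma> T \<tau> = p * gibbs_cond K H (S \<inter> pinnable ty G) \<sigma> T \<tau>"
      unfolding gibbs_cond_def gp eq by (simp add: Q_def[abs_def] pin_def)
  qed
qed

text \<open>Two boundary conditions are compared through the unconditional probability, which gives
  \<open>2 * \<delta>\<close> by the triangle inequality. The isolated nodes of \<open>S\<close>
  only multiply the difference by a factor at most 1.\<close>

lemma range_dep_bounds:
  fixes ty :: interpolation and G :: "('v, real) dgraph" and \<eta> :: "'v \<Rightarrow> nat"
  assumes dg: "decorated_graph K G" and K: "K \<ge> 1" and R: "R \<ge> 1"
    and sub: "\<Lambda> \<subseteq> verts G" "S \<subseteq> verts G"
  defines "H \<equiv> reduced_graph ty G \<Lambda> \<eta>"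
  assumes Z: "partition_fun K H \<noteq> 0"
    and close: "\<And>\<sigma> \<tau>. \<sigma> \<in> (S \<inter> pinnable ty G) \<rightarrow>\<^sub>E {1..K} \<Longrightarrow>
      gibbs_marginal K H (gboundary H S R) \<tau> > 0 \<Longrightarrow>
      \<bar>gibbs_cond K H (S \<inter> pinnable ty G) \<sigma> (gboundary H S R) \<tau> -
        gibbs_marginal K H (S \<inter> pinnable ty G) \<sigma>\<bar> \<le> \<delta>"
  shows "0 \<le> range_dep K R H S" and "range_dep K R H S \<le> 2 * \<delta>"
proof -
  let ?T = "gboundary H S R" and ?S = "S \<inter> pinnable ty G"
  let ?A = "{\<bar>gibbs_cond K H S \<sigma> ?T \<tau>1 - gibbs_cond K H S \<sigma> ?T \<tau>2\<bar> | \<sigma> \<tau>1 \<tau>2.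
            \<sigma> \<in> S \<rightarrow>\<^sub>E {1..K} \<and>
            \<tau>1 \<in> ?T \<rightarrow>\<^sub>E {1..K} \<and> gibbs_marginal K H ?T \<tau>1 > 0 \<and>
            \<tau>2 \<in> ?T \<rightarrow>\<^sub>E {1..K} \<and> gibbs_marginal K H ?T \<tau>2 > 0}"
  have pinH: "pinnable ty H = pinnable ty G"
    by (simp add: H_def pinnable_def split: interpolation.split)
  have vH: "verts H = verts G" by (simp add: H_def)
  have finV: "finite (verts G)" using dg by (simp add: decorated_graph_def)
  have TV: "?T \<subseteq> verts G \<inter> pinnable ty G"
    using gboundary_subset_pinnable[OF R, of H S ty] by (simp add: pinH vH)
  have finS: "finite S" and finT: "finite ?T" using sub TV finV by (auto dest: finite_subset)
  have fin: "finite ?A"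
  proof (rule finite_subset)
    show "?A \<subseteq> (\<lambda>(\<sigma>, \<tau>1, \<tau>2). \<bar>gibbs_cond K H S \<sigma> ?T \<tau>1 - gibbs_cond K H S \<sigma> ?T \<tau>2\<bar>) `
        ((S \<rightarrow>\<^sub>E {1..K}) \<times> (?T \<rightarrow>\<^sub>E {1..K}) \<times> (?T \<rightarrow>\<^sub>E {1..K}))"
    proof clarify
      fix \<sigma> \<tau>1 \<tau>2 assume "\<sigma> \<in> S \<rightarrow>\<^sub>E {1..K}" "\<tau>1 \<in> ?T \<rightarrow>\<^sub>E {1..K}" "\<tau>2 \<in> ?T \<rightarrow>\<^sub>E {1..K}"
      then show "\<bar>gibbs_cond K H S \<sigma> ?T \<tau>1 - gibbs_cond K H S \<sigma> ?T \<tau>2\<bar> \<in>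
          (\<lambda>(\<sigma>, \<tau>1, \<tau>2). \<bar>gibbs_cond K H S \<sigma> ?T \<tau>1 - gibbs_cond K H S \<sigma> ?T \<tau>2\<bar>) `
          ((S \<rightarrow>\<^sub>E {1..K}) \<times> (?T \<rightarrow>\<^sub>E {1..K}) \<times> (?T \<rightarrow>\<^sub>E {1..K}))"
        by (intro image_eqI[of _ _ "(\<sigma>, \<tau>1, \<tau>2)"]) auto
    qed
    show "finite \<dots>" using finS finT by (intro finite_imageI finite_SigmaI finite_PiE) auto
  qed
  have wH: "weight H \<phi> \<ge> 0" if "\<phi> \<in> verts H \<rightarrow>\<^sub>E {1..K}" for \<phi>
    using weight_reduced_graph[OF dg sub(1), of \<phi>] weight_nonneg[OF dg, of \<phi>] that
    unfolding vH by (simp add: H_def)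
  have mass_nnH: "mass K H P \<ge> 0" for P
    unfolding mass_def using wH by (intro sum_nonneg mult_nonneg_nonneg) auto
  \<comment> \<open>The maximum is attained only if some boundary condition has positive
    probability; the restriction of a configuration of nonzero weight is one. For
    \<open>\<sigma>\<close> the constant colour 1 serves, as \<open>K \<ge> 1\<close>.\<close>
  have ne: "?A \<noteq> {}"
  proof -
    have Zpos: "mass K H (\<lambda>_. True) > 0"
      using Z mass_nnH[of "\<lambda>_. True"] by (simp add: partition_fun_eq_mass)
    then obtain \<phi> where \<phi>: "\<phi> \<in> verts H \<rightarrow>\<^sub>E {1..K}" "weight H \<phi> \<noteq> 0"
      by (rule mass_posE)
    let ?\<tau> = "restrict \<phi> ?T"
    have finO: "finite (verts H \<rightarrow>\<^sub>E {1..K})" unfolding vH using finite_configs[OF dg] .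
    have "mass K H (\<lambda>\<phi>. \<forall>u\<in>?T. \<phi> u = ?\<tau> u) > 0"
      unfolding mass_def
      by (rule sum_pos2[OF finO \<phi>(1)]) (use wH[OF \<phi>(1)] \<phi>(2) wH in auto)
    then have "gibbs_marginal K H ?T ?\<tau> > 0"
      unfolding gibbs_marginal_def using gibbs_prob_eq_mass[of H] finV Zpos
      by (simp add: vH partition_fun_eq_mass)
    moreover have "?\<tau> \<in> ?T \<rightarrow>\<^sub>E {1..K}" using \<phi>(1) TV unfolding vH by auto
    moreover have "(\<lambda>u\<in>S. 1) \<in> S \<rightarrow>\<^sub>E {1..K}" using K by auto
    ultimately show ?thesis by blast
  qed
  have rd: "range_dep K R H S = Max ?A" by (simp add: range_dep_def)
  have "range_dep K R H S \<in> ?A" unfolding rd using Max_in[OF fin ne] .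
  then obtain \<sigma> \<tau>1 \<tau>2 where \<sigma>: "\<sigma> \<in> S \<rightarrow>\<^sub>E {1..K}"
      and \<tau>: "gibbs_marginal K H ?T \<tau>1 > 0" "gibbs_marginal K H ?T \<tau>2 > 0"
      and eq: "range_dep K R H S = \<bar>gibbs_cond K H S \<sigma> ?T \<tau>1 - gibbs_cond K H S \<sigma> ?T \<tau>2\<bar>"
    by blast
  show "0 \<le> range_dep K R H S" unfolding eq by simp
  have "?T \<subseteq> pinnable ty G" using TV by simp
  then obtain p where p: "0 \<le> p" "p \<le> 1"
    "\<And>\<tau>. gibbs_cond K H S \<sigma> ?T \<tau> = p * gibbs_cond K H ?S \<sigma> ?T \<tau>"
    using gibbs_cond_isolated[OF dg sub _ Z[unfolded H_def], folded H_def, where \<sigma> = \<sigma>] by metis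
  have \<sigma>': "restrict \<sigma> ?S \<in> ?S \<rightarrow>\<^sub>E {1..K}" using \<sigma> by auto
  let ?x = "gibbs_cond K H ?S \<sigma> ?T \<tau>1 - gibbs_cond K H ?S \<sigma> ?T \<tau>2"
  have "\<bar>?x\<bar> \<le> 2 * \<delta>"
    using close[OF \<sigma>' \<tau>(1)] close[OF \<sigma>' \<tau>(2)] unfolding gibbs_cond_restrict by linarith
  moreover have "range_dep K R H S = p * \<bar>?x\<bar>"
    unfolding eq p(3) using p(1) by (simp add: abs_mult flip: right_diff_distrib)
  moreover have "p * \<bar>?x\<bar> \<le> \<bar>?x\<bar>" using p by (simp add: mult_left_le_one_le)
  ultimately show "range_dep K R H S \<le> 2 * \<delta>" by linarith
qed

section \<open>The bound for a single graph, uniform thresholds and the limit\<close>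

lemma range_dep_reduced_bounds:
  fixes G :: "('v, real) dgraph"
  assumes dg: "decorated_graph K G" and K: "K \<ge> 1" and V: "verts G \<noteq> {}" and ZG: "partition_fun K G \<noteq> 0"
    and hc: "ty = TypeI \<Longrightarrow> hard_core G"
    and \<epsilon>: "0 < \<epsilon>" "\<epsilon> < 1" and m: "0 \<le> m" "2 * m + 4 \<le> real R"
    and approx: "\<And>\<Theta> \<theta>. \<Theta> \<subseteq> verts G \<Longrightarrow> \<theta> \<in> \<Theta> \<rightarrow>\<^sub>E {1..K} \<Longrightarrow>
      partition_fun K (reduced_graph ty G \<Theta> \<theta>) \<noteq> 0 \<Longrightarrow> taylor_approx \<epsilon> ty K G m \<Theta> \<theta>"
    and sub: "\<Lambda> \<subseteq> verts G" "S \<subseteq> verts G" and \<eta>: "\<eta> \<in> \<Lambda> \<rightarrow>\<^sub>E {1..K}"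
    and Z: "partition_fun K (reduced_graph ty G \<Lambda> \<eta>) \<noteq> 0"
  shows "0 \<le> range_dep K R (reduced_graph ty G \<Lambda> \<eta>) S"
    and "range_dep K R (reduced_graph ty G \<Lambda> \<eta>) S \<le> 2 * (((1 + \<epsilon>) / (1 - \<epsilon>))\<^sup>2 - 1)"
proof -
  let ?H = "reduced_graph ty G \<Lambda> \<eta>"
  let ?S = "S \<inter> pinnable ty G" and ?T = "gboundary ?H S R"
  have R: "R \<ge> 1" using m by linarith
  have approx': "taylor_approx \<epsilon> ty K G m \<Theta> \<theta>"
    if "\<Theta> \<subseteq> verts G" "\<theta> \<in> \<Theta> \<rightarrow> {1..K}" "partition_fun K (reduced_graph ty G \<Theta> \<theta>) \<noteq> 0" for \<Theta> \<theta>
    using approx[of \<Theta> "restrict \<theta> \<Theta>"] that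
    by (simp add: taylor_approx_def reduced_graph_restrict taylor_T_restrict restrict_PiE_iff Pi_iff)
  have "pinnable ty ?H = pinnable ty G"
    by (simp add: pinnable_def split: interpolation.split)
  then have TV: "?T \<subseteq> verts G \<inter> pinnable ty G"
    using gboundary_subset_pinnable[OF R, of ?H S ty] by simp
  have adj: "adj_rel ?H = adj_rel G" by (simp add: adj_rel_def)
  \<comment> \<open>The boundary remains that of the whole of \<open>S\<close>, although
    \<open>?S\<close> leaves out the nodes that cannot be pinned.\<close>
  have "separated ?H ?S ?T R" by (rule gboundary_separated) (use R in auto)
  then have sep: "separated G ?S ?T R" unfolding separated_def adj .
  \<comment> \<open>The least natural number exceeding \<open>m\<close>; since
    \<open>r \<le> m + 1\<close>, the assumption \<open>2 * m + 4 \<le> real R\<close> gives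
    \<open>2 * r + 2 \<le> R\<close>.\<close>
  define r where "r = nat \<lfloor>m\<rfloor> + 1"
  have "real (nat \<lfloor>m\<rfloor>) \<le> m" using m(1) by simp
  then have "real (2 * r + 2) \<le> real R" using m(2) by (simp add: r_def)
  then have r: "m < real r" "2 * r + 2 \<le> R" unfolding of_nat_le_iff r_def by linarith+
  have fug: "fugacity G > 0" if "ty = TypeI"
  proof -
    have "(SOME u. u \<in> verts G) \<in> verts G" using V by (simp add: some_in_eq)
    then show ?thesis using hc[OF that] unfolding hard_core_def fugacity_def by metis
  qed
  have avec_nn: "(\<Prod>u\<in>verts G. avec G u (\<phi> u)) \<ge> 0" if "\<phi> \<in> verts G \<rightarrow>\<^sub>E {1..K}" for \<phi>
    using dg PiE_mem[OF that] unfolding decorated_graph_def by (intro prod_nonneg) blast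
  \<comment> \<open>A nonzero partition function requires a configuration of nonzero weight, in
    particular one whose node weights are all nonzero.\<close>
  have avec: "(\<Sum>\<phi>\<in>verts G \<rightarrow>\<^sub>E {1..K}. \<Prod>u\<in>verts G. avec G u (\<phi> u)) > 0"
  proof -
    have "\<exists>\<phi>\<in>verts G \<rightarrow>\<^sub>E {1..K}. weight G \<phi> \<noteq> 0"
      using ZG unfolding partition_fun_def by (metis sum.neutral)
    then obtain \<phi> where "\<phi> \<in> verts G \<rightarrow>\<^sub>E {1..K}" "(\<Prod>u\<in>verts G. avec G u (\<phi> u)) \<noteq> 0"
      by (auto simp: weight_def)
    then show ?thesis
      using avec_nn by (intro sum_pos2[OF finite_configs[OF dg]]) (auto simp: less_le)
  qed
  have subs: "?S \<subseteq> verts G" "?T \<subseteq> verts G" "?S \<subseteq> verts G \<inter> pinnable ty G" using sub TV by auto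
  have add: "taylor_T ty K G (\<Lambda> \<union> ?S \<union> ?T) \<theta> m 1 + taylor_T ty K G \<Lambda> \<theta> m 1 =
      taylor_T ty K G (\<Lambda> \<union> ?T) \<theta> m 1 + taylor_T ty K G (\<Lambda> \<union> ?S) \<theta> m 1" for \<theta>
    by (rule taylor_T_additive[OF dg sep r(2,1) sub(1) subs(1,2) fug avec])
  have \<eta>': "\<eta> \<in> \<Lambda> \<rightarrow> {1..K}" using \<eta> by (auto simp: PiE_def)
  note close = abs_gibbs_cond_diff_marginal_le[OF dg sub(1) subs(3) TV \<eta>' \<epsilon> approx' add]
  show "0 \<le> range_dep K R ?H S" "range_dep K R ?H S \<le> 2 * (((1 + \<epsilon>) / (1 - \<epsilon>))\<^sup>2 - 1)"
    using range_dep_bounds[OF dg K R sub Z close] by blast+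
qed

text \<open>The approximation hypothesis grants a threshold for each sequence of pinnings
  separately. Choosing for every \<open>n\<close> a counterexample whenever one exists, and any
  valid choice otherwise, yields one sequence whose threshold serves for all of them.\<close>

lemma uniform_threshold:
  fixes valid good :: "nat \<Rightarrow> 'p \<Rightarrow> bool"
  assumes ex: "\<And>n. n \<ge> 1 \<Longrightarrow> \<exists>p. valid n p"
    and seq: "\<And>f. (\<And>n. n \<ge> 1 \<Longrightarrow> valid n (f n)) \<Longrightarrow> \<exists>N. \<forall>n\<ge>N. good n (f n)"
  shows "\<exists>N. \<forall>n\<ge>N. \<forall>p. n \<ge> 1 \<longrightarrow> valid n p \<longrightarrow> good n p"
proof -
  have "\<forall>n. \<exists>p. n \<ge> 1 \<longrightarrow> valid n p \<and> ((\<exists>q. valid n q \<and> \<not> good n q) \<longrightarrow> \<not> good n p)"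
    using ex by metis
  then obtain f where f: "\<And>n. n \<ge> 1 \<Longrightarrow> valid n (f n)"
      "\<And>n q. n \<ge> 1 \<Longrightarrow> valid n q \<Longrightarrow> \<not> good n q \<Longrightarrow> \<not> good n (f n)"
    by metis
  then show ?thesis using seq[OF f(1)] by metis
qed

theorem corollary3p2:
  fixes K :: nat
    and ty :: interpolation
    and G :: "nat \<Rightarrow> ('v, real) dgraph"
    and R :: "nat \<Rightarrow> nat"
  assumes K_pos: "K \<ge> 1"
    and graphs: "\<And>n. n \<ge> 1 \<Longrightarrow> decorated_graph K (G n)"
    and card_verts: "\<And>n. n \<ge> 1 \<Longrightarrow> card (verts (G n)) = n"
    and Z_nonzero: "\<And>n. n \<ge> 1 \<Longrightarrow> partition_fun K (G n) \<noteq> 0"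
    and type_I: "ty = TypeI \<Longrightarrow> K = 2 \<and> (\<forall>n\<ge>1. hard_core (G n))"
    and approx: "\<And>\<epsilon>::real. \<epsilon> > 0 \<Longrightarrow>
      \<exists>c::real. \<forall>(\<Lambda> :: nat \<Rightarrow> 'v set) (\<eta> :: nat \<Rightarrow> 'v \<Rightarrow> nat).
        (\<forall>n\<ge>1. \<Lambda> n \<subseteq> verts (G n) \<and> \<eta> n \<in> \<Lambda> n \<rightarrow>\<^sub>E {1..K} \<and>
                partition_fun K (reduced_graph ty (G n) (\<Lambda> n) (\<eta> n)) \<noteq> 0) \<longrightarrow>
        (\<exists>N. \<forall>n\<ge>N. \<forall>m::real. m \<ge> 0 \<longrightarrow> m \<ge> c * ln (real n) \<longrightarrow>
          (1 - \<epsilon>) * partition_fun K (reduced_graph ty (G n) (\<Lambda> n) (\<eta> n))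
            \<le> exp (Re (taylor_T ty K (G n) (\<Lambda> n) (\<eta> n) m 1)) \<and>
          exp (Re (taylor_T ty K (G n) (\<Lambda> n) (\<eta> n) m 1))
            \<le> (1 + \<epsilon>) * partition_fun K (reduced_graph ty (G n) (\<Lambda> n) (\<eta> n)))"
    and R_pos: "\<And>n. n \<ge> 1 \<Longrightarrow> R n \<ge> 1"
    and R_omega_log: "filterlim (\<lambda>n. real (R n) / ln (real n)) at_top sequentially"
  shows "(\<lambda>n. SUP (S, \<Lambda>, \<eta>) \<in> {(S, \<Lambda>, \<eta>). S \<subseteq> verts (G n) \<and> \<Lambda> \<subseteq> verts (G n) \<and>
                   \<eta> \<in> \<Lambda> \<rightarrow>\<^sub>E {1..K} \<and> partition_fun K (reduced_graph ty (G n) \<Lambda> \<eta>) \<noteq> 0}.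
              range_dep K (R n) (reduced_graph ty (G n) \<Lambda> \<eta>) S) \<longlonglongrightarrow> 0"
proof (rule LIMSEQ_I)
  fix e :: real assume e: "e > 0"
  \<comment> \<open>For \<open>\<epsilon> \<le> 1/2\<close> the squared ratio is at most
    \<open>(1 + 4 * \<epsilon>)\<^sup>2 \<le> 1 + 16 * \<epsilon>\<close>; then
    \<open>2 * \<delta> \<le> 32 * \<epsilon> \<le> e / 2\<close>.\<close>
  define \<epsilon> where "\<epsilon> = min (1/2) (e / 64)"
  have \<epsilon>: "0 < \<epsilon>" "\<epsilon> < 1" "\<epsilon> \<le> 1/2" "\<epsilon> \<le> e / 64" using e by (auto simp: \<epsilon>_def)
  define \<delta> where "\<delta> = ((1 + \<epsilon>) / (1 - \<epsilon>))\<^sup>2 - 1"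
  have \<delta>: "2 * \<delta> < e"
  proof -
    have "(1 + \<epsilon>) / (1 - \<epsilon>) \<le> 1 + 4 * \<epsilon>"
      using \<epsilon> mult_left_mono[of \<epsilon> "1/2" \<epsilon>] by (simp add: pos_divide_le_eq algebra_simps)
    then have "((1 + \<epsilon>) / (1 - \<epsilon>))\<^sup>2 \<le> (1 + 4 * \<epsilon>)\<^sup>2"
      using \<epsilon> by (intro power_mono) auto
    also have "\<dots> = 1 + 8 * \<epsilon> + 16 * (\<epsilon> * \<epsilon>)" by (simp add: power2_eq_square algebra_simps)
    also have "\<dots> \<le> 1 + 16 * \<epsilon>" using \<epsilon> mult_left_mono[of \<epsilon> "1/2" \<epsilon>] by simp
    finally show ?thesis using \<epsilon> e by (simp add: \<delta>_def)
  qed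
  define valid where "valid n = (\<lambda>(\<Lambda>, \<eta>). \<Lambda> \<subseteq> verts (G n) \<and> \<eta> \<in> \<Lambda> \<rightarrow>\<^sub>E {1..K} \<and>
      partition_fun K (reduced_graph ty (G n) \<Lambda> \<eta>) \<noteq> 0)" for n
  \<comment> \<open>The empty pinning is always admissible. It completes sequences in
    \<open>uniform_threshold\<close> and shows that the supremum is over a nonempty set.\<close>
  have valid_empty: "valid n ({}, \<lambda>_. undefined)" if "n \<ge> 1" for n
  proof -
    have "partition_fun K (reduced_graph ty (G n) {} (\<lambda>_. undefined)) = partition_fun K (G n)"
      using mass_reduced_graph[OF graphs[OF that], of "{}"] by (simp add: partition_fun_eq_mass)
    then show ?thesis using Z_nonzero[OF that] by (simp add: valid_def)
  qed
  have "\<exists>c. \<forall>\<Lambda> \<eta>. (\<forall>n\<ge>1. valid n (\<Lambda> n, \<eta> n)) \<longrightarrow>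
      (\<exists>N. \<forall>n\<ge>N. \<forall>m. m \<ge> 0 \<longrightarrow> m \<ge> c * ln (real n) \<longrightarrow> taylor_approx \<epsilon> ty K (G n) m (\<Lambda> n) (\<eta> n))"
    using approx[OF \<epsilon>(1)] unfolding valid_def taylor_approx_def case_prod_conv .
  then obtain c where c: "\<forall>\<Lambda> \<eta>. (\<forall>n\<ge>1. valid n (\<Lambda> n, \<eta> n)) \<longrightarrow>
      (\<exists>N. \<forall>n\<ge>N. \<forall>m. m \<ge> 0 \<longrightarrow> m \<ge> c * ln (real n) \<longrightarrow> taylor_approx \<epsilon> ty K (G n) m (\<Lambda> n) (\<eta> n))"
    ..
  define good where "good n = (\<lambda>(\<Lambda>, \<eta>). \<forall>m. m \<ge> 0 \<longrightarrow> m \<ge> c * ln (real n) \<longrightarrow>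
      taylor_approx \<epsilon> ty K (G n) m \<Lambda> \<eta>)" for n
  have "\<exists>N. \<forall>n\<ge>N. \<forall>p. n \<ge> 1 \<longrightarrow> valid n p \<longrightarrow> good n p"
  proof (rule uniform_threshold)
    show "\<exists>p. valid n p" if "n \<ge> 1" for n using valid_empty[OF that] ..
    show "\<exists>N. \<forall>n\<ge>N. good n (f n)" if "\<And>n. n \<ge> 1 \<Longrightarrow> valid n (f n)" for f
      using c[rule_format, of "\<lambda>n. fst (f n)" "\<lambda>n. snd (f n)"] that
      by (simp add: good_def case_prod_unfold)
  qed
  then obtain N1 where N1: "\<And>n p. n \<ge> N1 \<Longrightarrow> n \<ge> 1 \<Longrightarrow> valid n p \<Longrightarrow> good n p" by blast
  \<comment> \<open>The constant \<open>c\<close> may be negative, whereas the truncation order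
    \<open>m\<close> must not be.\<close>
  define c' where "c' = max 0 c"
  \<comment> \<open>Once \<open>ln (real n) \<ge> 1\<close>, which holds from \<open>n = 3\<close>
    on, multiplying by it yields \<open>2 * m + 4 \<le> real (R n)\<close> for
    \<open>m = c' * ln (real n)\<close>.\<close>
  obtain N2 where N2: "\<And>n. n \<ge> N2 \<Longrightarrow> 2 * c' + 4 \<le> real (R n) / ln (real n)"
    using R_omega_log unfolding filterlim_at_top eventually_sequentially by blast
  show "\<exists>N. \<forall>n\<ge>N. norm ((SUP (S, \<Lambda>, \<eta>) \<in> {(S, \<Lambda>, \<eta>). S \<subseteq> verts (G n) \<and> \<Lambda> \<subseteq> verts (G n) \<and>
                   \<eta> \<in> \<Lambda> \<rightarrow>\<^sub>E {1..K} \<and> partition_fun K (reduced_graph ty (G n) \<Lambda> \<eta>) \<noteq> 0}.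
              range_dep K (R n) (reduced_graph ty (G n) \<Lambda> \<eta>) S) - 0) < e"
  proof (intro exI[of _ "max 3 (max N1 N2)"] allI impI)
    fix n assume "n \<ge> max 3 (max N1 N2)"
    then have n: "n \<ge> 3" "n \<ge> N1" "n \<ge> N2" "n \<ge> 1" by auto
    have "exp 1 \<le> real n" using exp_le n(1) by linarith
    then have ln1: "ln (real n) \<ge> 1" using n by (simp add: ln_ge_iff)
    define m where "m = c' * ln (real n)"
    have m: "0 \<le> m" "c * ln (real n) \<le> m"
      using ln1 by (auto simp: m_def c'_def intro!: mult_right_mono)
    have "(2 * c' + 4) * ln (real n) \<le> real (R n)"
      using N2[OF n(3)] ln1 by (simp add: pos_le_divide_eq)
    then have mR: "2 * m + 4 \<le> real (R n)"
      using ln1 by (simp add: m_def algebra_simps)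
    define A where "A = {(S, \<Lambda>, \<eta>). S \<subseteq> verts (G n) \<and> \<Lambda> \<subseteq> verts (G n) \<and>
        \<eta> \<in> \<Lambda> \<rightarrow>\<^sub>E {1..K} \<and> partition_fun K (reduced_graph ty (G n) \<Lambda> \<eta>) \<noteq> 0}"
    define f where "f = (\<lambda>(S, \<Lambda>, \<eta>). range_dep K (R n) (reduced_graph ty (G n) \<Lambda> \<eta>) S)"
    have f: "0 \<le> f x \<and> f x \<le> 2 * \<delta>" if "x \<in> A" for x
    proof -
      obtain S \<Lambda> \<eta> where x: "x = (S, \<Lambda>, \<eta>)" by (cases x)
      have "verts (G n) \<noteq> {}" using card_verts[OF n(4)] n(4) by auto
      moreover have "taylor_approx \<epsilon> ty K (G n) m \<Theta> \<theta>" if "\<Theta> \<subseteq> verts (G n)" "\<theta> \<in> \<Theta> \<rightarrow>\<^sub>E {1..K}"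
          "partition_fun K (reduced_graph ty (G n) \<Theta> \<theta>) \<noteq> 0" for \<Theta> \<theta>
        using N1[OF n(2,4), of "(\<Theta>, \<theta>)"] that m by (auto simp: valid_def good_def)
      moreover have "hard_core (G n)" if "ty = TypeI" using type_I[OF that] n(4) by blast
      ultimately show ?thesis
        using range_dep_reduced_bounds[OF graphs[OF n(4)] K_pos _ Z_nonzero[OF n(4)] _ \<epsilon>(1,2) m(1) mR,
            of ty \<Lambda> S \<eta>] that
        by (simp add: A_def f_def x \<delta>_def)
    qed
    have ne: "({}, {}, \<lambda>_. undefined) \<in> A"
      using valid_empty[OF n(4)] by (simp add: A_def valid_def)
    have "Sup (f ` A) \<le> 2 * \<delta>" using ne f by (intro cSUP_least) auto
    moreover have "0 \<le> Sup (f ` A)"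
      using f ne by (intro cSUP_upper2[OF _ ne]) (auto intro!: bdd_aboveI2[where M = "2 * \<delta>"])
    ultimately show "norm ((SUP (S, \<Lambda>, \<eta>) \<in> {(S, \<Lambda>, \<eta>). S \<subseteq> verts (G n) \<and> \<Lambda> \<subseteq> verts (G n) \<and>
                   \<eta> \<in> \<Lambda> \<rightarrow>\<^sub>E {1..K} \<and> partition_fun K (reduced_graph ty (G n) \<Lambda> \<eta>) \<noteq> 0}.
              range_dep K (R n) (reduced_graph ty (G n) \<Lambda> \<eta>) S) - 0) < e"
      unfolding A_def[symmetric] f_def[symmetric] using \<delta> by simp
  qed
qed

end
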